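(* Let $C\in\mathcal{C}_{ev}$ be an Extreme Value copula and let $\vartheta\in\mathcal{P}_{\mathcal{A}}$ be its associated Pickands dependence measure. Then the following assertions hold: (i) If $\vartheta^{dis}$ has full support (i.e. $\mathrm{supp}(\vartheta^{dis})=\mathbb{I}$), then $\mathrm{supp}(\mu_C^{dis})=\mathbb{I}^2$. (ii) If $\vartheta^{sing}$ has full support, then $\mathrm{supp}(\mu_C^{sing})=\mathbb{I}^2$. (iii) If $L=0$ and $R=1$, then $\mathrm{supp}(\mu_C^{abs})=\mathbb{I}^2$, where, with $A$ the Pickands dependence function corresponding to $\vartheta$, $L=\max\{x\in\mathbb{I}:A(x)=1-x\}$ and $R=\min\{x\in\mathbb{I}:A(x)=x\}$.
   Context: $\mathbb{I}=[0,1]$; $\lambda$ is Lebesgue measure on $\mathbb{I}$. A bivariate copula $C$ is the restriction to $\mathbb{I}^2$ of a bivariate distribution function with uniform marginals on $\mathbb{I}$; $\mu_C$ is its doubly stochastic measure, $\mu_C([0,x]\times[0,y])=C(x,y)$. $C$ is an Extreme Value copula (EVC), $C\in\mathcal{C}_{ev}$, if there is a copula $B$ with $C(x,y)=\lim_{n\to\infty}B^n(x^{1/n},y^{1/n})$ for all $x,y\in\mathbb{I}$. $\mathcal{A}$ is the set of Pickands dependence functions: convex $A:\mathbb{I}\to\mathbb{I}$ with $\max\{1-t,t\}\le A(t)\le1$. $\mathcal{P}_{\mathcal{A}}$ is the set of Pickands dependence measures: Borel probability measures $\vartheta$ on $\mathbb{I}$ with $\int_{\mathbb{I}}x\,d\vartheta(x)=\frac12$.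 They are in one-to-one-to-one correspondence with EVCs via $A(t)=1-t+2\int_{[0,t]}\vartheta([0,z])\,d\lambda(z)$, $t\in\mathbb{I}$, and $C(x,y)=(xy)^{A(\log(x)/\log(xy))}$, $x,y\in(0,1)$. A finite measure is called singular if it has no point masses and is concentrated on a Lebesgue null set; $\vartheta=\vartheta^{abs}+\vartheta^{dis}+\vartheta^{sing}$ is the Lebesgue decomposition of $\vartheta$ into absolutely continuous, discrete and singular parts. Let $K_C$ be the Markov kernel of $C$ (regular conditional distribution of $Y$ given $X$ for $(X,Y)\sim C$, so $\mu_C(E\times F)=\int_EK_C(x,F)\,d\lambda(x)$), and decompose $K_C(x,\cdot)=K_C^{abs}(x,\cdot)+K_C^{dis}(x,\cdot)+K_C^{sing}(x,\cdot)$ into absolutely continuous, discrete and singular sub-Markov kernels. For $\ast\in\{abs,dis,sing\}$, $\mu_C^{\ast}$ is the measure on $\mathbb{I}^2$ with $\mu_C^{\ast}(E\times F)=\int_EK_C^{\ast}(x,F)\,d\lambda(x)$. The support of a measure is the complement of the union of all open sets of measure zero. *)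

theory Defs
  imports "HOL-Probability.Probability"
begin

section \<open>The unit interval, the unit square and supports\<close>

definition unit_lebesgue :: "real measure" where
  "unit_lebesgue = restrict_space lborel {0..1}"

abbreviation unit_square :: "(real \<times> real) measure" where
  "unit_square \<equiv> unit_lebesgue \<Otimes>\<^sub>M unit_lebesgue"

lemma space_unit_lebesgue [simp]: "space unit_lebesgue = {0..1}"
  by (simp add: unit_lebesgue_def space_restrict_space)

lemma sets_unit_lebesgue: "sets unit_lebesgue = sets (restrict_space borel {0..1})"
  unfolding unit_lebesgue_def by (rule sets_restrict_space_cong) simp

lemma sets_unit_square:
  "sets unit_square = sets (restrict_space borel ({0..1} \<times> {0..1}))"
proof
  have pair: "(\<lambda>p. (fst p, snd p)) \<in> restrict_space borel ({0..1} \<times> {0..1}) \<rightarrow>\<^sub>M unit_square"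
  proof (rule measurable_Pair)
    have "fst \<in> restrict_space borel ({0..1::real} \<times> {0..1::real}) \<rightarrow>\<^sub>M restrict_space borel {0..1::real}"
      by (rule measurable_restrict_space3)
        (auto intro!: borel_measurable_continuous_onI continuous_intros)
    then show "fst \<in> restrict_space borel ({0..1::real} \<times> {0..1::real}) \<rightarrow>\<^sub>M unit_lebesgue"
      by (subst measurable_cong_sets[OF refl sets_unit_lebesgue])
    have "snd \<in> restrict_space borel ({0..1::real} \<times> {0..1::real}) \<rightarrow>\<^sub>M restrict_space borel {0..1::real}"
      by (rule measurable_restrict_space3)
        (auto intro!: borel_measurable_continuous_onI continuous_intros)
    then show "snd \<in> restrict_space borel ({0..1::real} \<times> {0..1::real}) \<rightarrow>\<^sub>M unit_lebesgue"
      by (subst measurable_cong_sets[OF refl sets_unit_lebesgue])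
  qed
  show "sets unit_square \<subseteq> sets (restrict_space borel ({0..1} \<times> {0..1}))"
  proof (intro subsetI)
    fix X assume X: "X \<in> sets unit_square"
    then have "X \<subseteq> {0..1} \<times> {0..1}"
      using sets.sets_into_space[OF X] by (simp add: space_pair_measure)
    then have "(\<lambda>p. (fst p, snd p)) -` X \<inter> space (restrict_space borel ({0..1} \<times> {0..1})) = X"
      by (auto simp: space_restrict_space)
    with measurable_sets[OF pair X]
    show "X \<in> sets (restrict_space borel ({0..1} \<times> {0..1}))" by simp
  qed
  have id1: "(\<lambda>x. x) \<in> unit_lebesgue \<rightarrow>\<^sub>M borel"
    unfolding measurable_cong_sets[OF sets_unit_lebesgue refl]
    by (rule measurable_restrict_space1) simp
  have m: "(\<lambda>p. p) \<in> unit_square \<rightarrow>\<^sub>M borel"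
  proof -
    have "(\<lambda>p. (fst p, snd p)) \<in> unit_square \<rightarrow>\<^sub>M borel \<Otimes>\<^sub>M borel"
      by (intro measurable_Pair measurable_compose[OF measurable_fst id1]
          measurable_compose[OF measurable_snd id1])
    then show ?thesis by (simp add: borel_prod)
  qed
  show "sets (restrict_space borel ({0..1} \<times> {0..1})) \<subseteq> sets unit_square"
  proof
    fix X assume "X \<in> sets (restrict_space borel ({0..1::real} \<times> {0..1::real}))"
    then obtain Y where Y: "Y \<in> sets borel" "X = ({0..1} \<times> {0..1}) \<inter> Y"
      by (auto simp: sets_restrict_space)
    have "X = (\<lambda>p. p) -` Y \<inter> space unit_square"
      using Y(2) by (auto simp: space_pair_measure)
    with measurable_sets[OF m Y(1)] show "X \<in> sets unit_square" by simp
  qed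
qed

text \<open>
  The support relative to the underlying space: the measures below live on the unit interval or on
  the unit square, whose open subsets are the traces of the open sets of the ambient space.
\<close>

definition measure_support :: "'a::topological_space measure \<Rightarrow> 'a set" where
  "measure_support M =
     space M - \<Union>{U \<inter> space M | U. open U \<and> emeasure M (U \<inter> space M) = 0}"


section \<open>Copulas and Extreme Value copulas\<close>

text \<open>Only the values of \<open>C\<close> on the unit square are relevant.\<close>

definition copula :: "(real \<Rightarrow> real \<Rightarrow> real) \<Rightarrow> bool" where
  "copula C \<longleftrightarrow>
     (\<exists>M :: (real \<times> real) measure.
        prob_space M \<and> sets M = sets borel \<and>
        distr M borel fst = uniform_measure lborel {0..1} \<and>
        distr M borel snd = uniform_measure lborel {0..1} \<and>
        (\<forall>x\<in>{0..1}. \<forall>y\<in>{0..1}. C x y = measure M ({..x} \<times> {..y})))"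

definition copula_measure :: "(real \<Rightarrow> real \<Rightarrow> real) \<Rightarrow> (real \<times> real) measure" where
  "copula_measure C =
     (THE \<mu>. sets \<mu> = sets unit_square \<and>
        (\<forall>x\<in>{0..1}. \<forall>y\<in>{0..1}. emeasure \<mu> ({0..x} \<times> {0..y}) = ennreal (C x y)))"

definition evc :: "(real \<Rightarrow> real \<Rightarrow> real) \<Rightarrow> bool" where
  "evc C \<longleftrightarrow> copula C \<and>
     (\<exists>B. copula B \<and>
        (\<forall>x\<in>{0..1}. \<forall>y\<in>{0..1}. (\<lambda>n. B (root n x) (root n y) ^ n) \<longlonglongrightarrow> C x y))"


section \<open>Pickands dependence functions and measures\<close>

definition pickands_function :: "(real \<Rightarrow> real) \<Rightarrow> bool" where
  "pickands_function A \<longleftrightarrow>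
     convex_on {0..1} A \<and> (\<forall>t\<in>{0..1}. max (1 - t) t \<le> A t \<and> A t \<le> 1)"

definition pickands_measure :: "real measure \<Rightarrow> bool" where
  "pickands_measure \<theta> \<longleftrightarrow>
     prob_space \<theta> \<and> sets \<theta> = sets unit_lebesgue \<and> (\<integral>x. x \<partial>\<theta>) = 1 / 2"

definition function_of_pickands_measure :: "(real \<Rightarrow> real) \<Rightarrow> real measure \<Rightarrow> bool" where
  "function_of_pickands_measure A \<theta> \<longleftrightarrow>
     (\<forall>t\<in>{0..1}. A t = 1 - t + 2 * (\<integral>z\<in>{0..t}. measure \<theta> {0..z} \<partial>unit_lebesgue))"

definition copula_of_pickands_function ::
  "(real \<Rightarrow> real \<Rightarrow> real) \<Rightarrow> (real \<Rightarrow> real) \<Rightarrow> bool" where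
  "copula_of_pickands_function C A \<longleftrightarrow>
     (\<forall>x\<in>{0<..<1}. \<forall>y\<in>{0<..<1}. C x y = (x * y) powr A (ln x / ln (x * y)))"

text \<open>
  \<^const>\<open>Greatest\<close> and \<^const>\<open>Least\<close> are the order-theoretic maximum and minimum;
  \<^const>\<open>Max\<close> and \<^const>\<open>Min\<close> are meaningful only for finite sets.
\<close>

definition pickands_L :: "(real \<Rightarrow> real) \<Rightarrow> real" where
  "pickands_L A = (GREATEST x. x \<in> {0..1} \<and> A x = 1 - x)"

definition pickands_R :: "(real \<Rightarrow> real) \<Rightarrow> real" where
  "pickands_R A = (LEAST x. x \<in> {0..1} \<and> A x = x)"


section \<open>Lebesgue decomposition\<close>

definition discrete_on_unit :: "real measure \<Rightarrow> bool" where
  "discrete_on_unit M \<longleftrightarrow>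
     (\<exists>D\<subseteq>{0..1}. countable D \<and> emeasure M ({0..1} - D) = 0)"

definition singular_on_unit :: "real measure \<Rightarrow> bool" where
  "singular_on_unit M \<longleftrightarrow>
     (\<forall>x\<in>{0..1}. emeasure M {x} = 0) \<and>
     (\<exists>N\<in>null_sets unit_lebesgue. emeasure M ({0..1} - N) = 0)"

definition lebesgue_decomposition ::
  "real measure \<Rightarrow> real measure \<Rightarrow> real measure \<Rightarrow> real measure \<Rightarrow> bool" where
  "lebesgue_decomposition M Mabs Mdis Msing \<longleftrightarrow>
     sets Mabs = sets unit_lebesgue \<and> sets Mdis = sets unit_lebesgue \<and>
     sets Msing = sets unit_lebesgue \<and>
     (\<forall>E\<in>sets unit_lebesgue. emeasure M E = emeasure Mabs E + emeasure Mdis E + emeasure Msing E) \<and>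
     absolutely_continuous unit_lebesgue Mabs \<and> discrete_on_unit Mdis \<and> singular_on_unit Msing"


section \<open>Markov kernels\<close>

definition markov_kernel_of :: "(real \<Rightarrow> real \<Rightarrow> real) \<Rightarrow> (real \<Rightarrow> real measure) \<Rightarrow> bool" where
  "markov_kernel_of C K \<longleftrightarrow>
     K \<in> unit_lebesgue \<rightarrow>\<^sub>M prob_algebra unit_lebesgue \<and>
     (\<forall>E\<in>sets unit_lebesgue. \<forall>F\<in>sets unit_lebesgue.
        emeasure (copula_measure C) (E \<times> F) = (\<integral>\<^sup>+x\<in>E. emeasure (K x) F \<partial>unit_lebesgue))"

definition sub_markov_kernel :: "(real \<Rightarrow> real measure) \<Rightarrow> bool" where
  "sub_markov_kernel K \<longleftrightarrow> K \<in> unit_lebesgue \<rightarrow>\<^sub>M subprob_algebra unit_lebesgue"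

definition kernel_decomposition ::
  "(real \<Rightarrow> real measure) \<Rightarrow> (real \<Rightarrow> real measure) \<Rightarrow> (real \<Rightarrow> real measure)
     \<Rightarrow> (real \<Rightarrow> real measure) \<Rightarrow> bool" where
  "kernel_decomposition K Kabs Kdis Ksing \<longleftrightarrow>
     sub_markov_kernel Kabs \<and> sub_markov_kernel Kdis \<and> sub_markov_kernel Ksing \<and>
     (\<forall>x\<in>{0..1}. lebesgue_decomposition (K x) (Kabs x) (Kdis x) (Ksing x))"

text \<open>The measure on the unit square with first marginal \<open>\<lambda>\<close> disintegrated along the kernel \<open>K\<close>.\<close>

definition kernel_measure :: "(real \<Rightarrow> real measure) \<Rightarrow> (real \<times> real) measure" where
  "kernel_measure K = unit_lebesgue \<bind> (\<lambda>x. distr (K x) unit_square (Pair x))"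

lemma kernel_measure_distr_measurable:
  assumes "sub_markov_kernel K"
  shows "(\<lambda>x. distr (K x) unit_square (Pair x)) \<in> unit_lebesgue \<rightarrow>\<^sub>M subprob_algebra unit_square"
  using assms unfolding sub_markov_kernel_def
  by (intro measurable_distr2[where L = unit_lebesgue]) auto

lemma sets_kernel_measure:
  assumes "sub_markov_kernel K"
  shows "sets (kernel_measure K) = sets unit_square"
  unfolding kernel_measure_def
  by (rule sets_bind[OF sets_kernel[OF kernel_measure_distr_measurable[OF assms]]]) simp_all

lemma emeasure_kernel_measure_times:
  assumes K: "sub_markov_kernel K"
    and E: "E \<in> sets unit_lebesgue" and F: "F \<in> sets unit_lebesgue"
  shows "emeasure (kernel_measure K) (E \<times> F) = (\<integral>\<^sup>+x\<in>E. emeasure (K x) F \<partial>unit_lebesgue)"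
proof -
  have "emeasure (kernel_measure K) (E \<times> F)
      = (\<integral>\<^sup>+x. emeasure (distr (K x) unit_square (Pair x)) (E \<times> F) \<partial>unit_lebesgue)"
    unfolding kernel_measure_def using E F
    by (intro emeasure_bind[OF _ kernel_measure_distr_measurable[OF K]]) auto
  also have "\<dots> = (\<integral>\<^sup>+x\<in>E. emeasure (K x) F \<partial>unit_lebesgue)"
  proof (rule nn_integral_cong)
    fix x assume x: "x \<in> space unit_lebesgue"
    have s: "sets (K x) = sets unit_lebesgue"
      using K x unfolding sub_markov_kernel_def by (rule sets_kernel)
    have m: "Pair x \<in> K x \<rightarrow>\<^sub>M unit_square"
      using x measurable_Pair1'[of x unit_lebesgue unit_lebesgue]
      by (simp add: measurable_cong_sets[OF s refl])
    have F': "F \<subseteq> space (K x)"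
      using F s sets.sets_into_space by metis
    have "emeasure (distr (K x) unit_square (Pair x)) (E \<times> F)
        = emeasure (K x) (Pair x -` (E \<times> F) \<inter> space (K x))"
      using E F by (intro emeasure_distr[OF m]) auto
    also have "Pair x -` (E \<times> F) \<inter> space (K x) = (if x \<in> E then F else {})"
      using F' by auto
    finally show "emeasure (distr (K x) unit_square (Pair x)) (E \<times> F)
        = emeasure (K x) F * indicator E x"
      by (auto simp: indicator_def)
  qed
  finally show ?thesis .
qed


section \<open>Well-definedness of the measure of a copula\<close>

lemma copula_measure_unique:
  assumes "sets \<mu> = sets unit_square" and "sets \<nu> = sets unit_square"
    and "\<And>x y. x \<in> {0..1} \<Longrightarrow> y \<in> {0..1} \<Longrightarrow> emeasure \<mu> ({0..x} \<times> {0..y}) = ennreal (C x y)"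
    and "\<And>x y. x \<in> {0..1} \<Longrightarrow> y \<in> {0..1} \<Longrightarrow> emeasure \<nu> ({0..x} \<times> {0..y}) = ennreal (C x y)"
  shows "\<mu> = \<nu>"
proof -
  define G :: "real set set" where "G = (\<lambda>x. {0..x}) ` {0..1}"
  have G_sub: "G \<subseteq> Pow {0..1}" by (auto simp: G_def)
  have gen: "sets unit_lebesgue = sigma_sets {0..1} G"
  proof
    have "sets unit_lebesgue = sigma_sets {0..1} ((\<inter>) {0..1} ` range (\<lambda>a::real. {..a}))"
    proof -
      have "sets (borel :: real measure) = sigma_sets UNIV (range (\<lambda>a::real. {..a}))"
        by (subst borel_eq_atMost) simp
      moreover have "{0..1::real} \<in> sigma_sets UNIV (range (\<lambda>a::real. {..a}))"
        unfolding calculation[symmetric] by simp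
      ultimately show ?thesis
        unfolding sets_unit_lebesgue sets_restrict_space
        using restricted_sigma[of "{0..1::real}" UNIV "range (\<lambda>a::real. {..a})"] by simp
    qed
    also have "\<dots> \<subseteq> sigma_sets {0..1} G"
    proof (rule sigma_sets_mono, safe)
      fix a :: real
      consider "a < 0" | "0 \<le> a" "a \<le> 1" | "1 < a" by linarith
      then show "{0..1} \<inter> {..a} \<in> sigma_sets {0..1} G"
      proof cases
        case 1
        then have "{0..1} \<inter> {..a} = {}" by auto
        then show ?thesis by (simp add: sigma_sets.Empty)
      next
        case 2
        then have "{0..1} \<inter> {..a} = {0..a}" by auto
        with 2 show ?thesis by (auto simp: G_def)
      next
        case 3
        then have "{0..1} \<inter> {..a} = {0..1}" by auto
        then show ?thesis by (metis sigma_sets_top)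
      qed
    qed
    finally show "sets unit_lebesgue \<subseteq> sigma_sets {0..1} G" .
    have "G \<subseteq> sets unit_lebesgue"
      by (auto simp: G_def sets_unit_lebesgue sets_restrict_space image_iff intro!: bexI[of _ "{0.._}"])
    then show "sigma_sets {0..1} G \<subseteq> sets unit_lebesgue"
      using sets.sigma_sets_subset[of G unit_lebesgue] by simp
  qed
  define P where "P = {a \<times> b | a b. a \<in> G \<and> b \<in> G}"
  have top: "{0..1} \<in> G" by (auto simp: G_def)
  have genP: "sets unit_square = sigma_sets ({0..1} \<times> {0..1}) P"
  proof -
    have "sets unit_square = sets (sigma {0..1} G \<Otimes>\<^sub>M sigma {0..1} G)"
      using gen G_sub by (intro sets_pair_measure_cong) simp_all
    also have "\<dots> = sets (sigma ({0..1} \<times> {0..1}) P)"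
      unfolding P_def using G_sub top
      by (intro arg_cong[where f = sets] sigma_prod exI[of _ "{{0..1}}"]) auto
    also have "\<dots> = sigma_sets ({0..1} \<times> {0..1}) P"
      using G_sub by (intro sets_measure_of) (auto simp: P_def)
    finally show ?thesis .
  qed
  show ?thesis
  proof (rule measure_eqI_generator_eq[where E = P and \<Omega> = "{0..1} \<times> {0..1}" and A = "\<lambda>_. {0..1} \<times> {0..1}"])
    show "Int_stable P"
    proof (rule Int_stableI)
      fix a b assume "a \<in> P" "b \<in> P"
      then obtain x y u v where h: "a = {0..x} \<times> {0..y}" "b = {0..u} \<times> {0..v}"
        "x \<in> {0..1}" "y \<in> {0..1}" "u \<in> {0..1}" "v \<in> {0..1}"
        by (auto simp: P_def G_def)
      then have "a \<inter> b = {0..min x u} \<times> {0..min y v}" by auto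
      moreover have "min x u \<in> {0..1}" "min y v \<in> {0..1}" using h by auto
      ultimately show "a \<inter> b \<in> P" unfolding P_def G_def by blast
    qed
    show "P \<subseteq> Pow ({0..1} \<times> {0..1})" using G_sub by (auto simp: P_def)
    show "emeasure \<mu> X = emeasure \<nu> X" if "X \<in> P" for X
      using that assms(3,4) by (auto simp: P_def G_def)
    show "sets \<mu> = sigma_sets ({0..1} \<times> {0..1}) P" "sets \<nu> = sigma_sets ({0..1} \<times> {0..1}) P"
      using assms(1,2) genP by auto
    show "range (\<lambda>_::nat. {0..1::real} \<times> {0..1::real}) \<subseteq> P"
      using top by (auto simp: P_def)
    show "(\<Union>i::nat. {0..1::real} \<times> {0..1::real}) = {0..1} \<times> {0..1}" by simp
    show "emeasure \<mu> ({0..1} \<times> {0..1}) \<noteq> \<infinity>" for i :: nat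
      using assms(3)[of 1 1] by simp
  qed
qed

lemma copula_measure_exists:
  assumes "copula C"
  shows "\<exists>\<mu>. sets \<mu> = sets unit_square \<and>
    (\<forall>x\<in>{0..1}. \<forall>y\<in>{0..1}. emeasure \<mu> ({0..x} \<times> {0..y}) = ennreal (C x y))"
proof -
  obtain M :: "(real \<times> real) measure" where M: "prob_space M" "sets M = sets borel"
      "distr M borel fst = uniform_measure lborel {0..1}"
      "distr M borel snd = uniform_measure lborel {0..1}"
      "\<And>x y. x \<in> {0..1} \<Longrightarrow> y \<in> {0..1} \<Longrightarrow> C x y = measure M ({..x} \<times> {..y})"
    using assms unfolding copula_def by blast
  interpret prob_space M by fact
  have sp: "space M = UNIV" using sets_eq_imp_space_eq[OF M(2)] by simp
  have f: "fst \<in> M \<rightarrow>\<^sub>M borel" and s: "snd \<in> M \<rightarrow>\<^sub>M borel"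
    unfolding measurable_cong_sets[OF M(2) refl]
    by (simp_all add: borel_measurable_continuous_onI continuous_on_fst continuous_on_snd continuous_on_id)
  have u: "emeasure (uniform_measure lborel {0..1::real}) {..<0} = 0"
  proof -
    have "{0..1} \<inter> {..<0} = ({} :: real set)" by auto
    then show ?thesis by simp
  qed
  have z1: "emeasure M (fst -` {..<0}) = 0"
    using emeasure_distr[OF f, of "{..<0}"] u M(3) sp by simp
  have z2: "emeasure M (snd -` {..<0}) = 0"
    using emeasure_distr[OF s, of "{..<0}"] u M(4) sp by simp
  have m1: "fst -` {..<0} \<in> sets M" "snd -` {..<0} \<in> sets M"
    using measurable_sets[OF f, of "{..<0}"] measurable_sets[OF s, of "{..<0}"] sp by auto
  define \<mu> where "\<mu> = restrict_space M ({0..1} \<times> {0..1})"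
  have "sets \<mu> = sets unit_square"
    unfolding \<mu>_def sets_unit_square by (rule sets_restrict_space_cong) (rule M(2))
  moreover have "emeasure \<mu> ({0..x} \<times> {0..y}) = ennreal (C x y)"
    if xy: "x \<in> {0..1}" "y \<in> {0..1}" for x y
  proof -
    have b: "{0..x} \<times> {0..y} \<in> sets M" "{..x} \<times> {..y} \<in> sets M"
        "{0..1} \<times> {0..1::real} \<in> sets M" for x y :: real
      unfolding M(2) by (auto intro!: borel_closed closed_Times)
    have "emeasure \<mu> ({0..x} \<times> {0..y}) = emeasure M ({0..x} \<times> {0..y})"
      unfolding \<mu>_def using xy b(3) sp by (intro emeasure_restrict_space) auto
    also have "\<dots> = emeasure M ({..x} \<times> {..y})"
    proof (rule emeasure_eq_AE)
      have "fst -` {..<0} \<union> snd -` {..<0} \<in> null_sets M"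
        using z1 z2 m1 by auto
      then show "AE p in M. (p \<in> {0..x} \<times> {0..y}) = (p \<in> {..x} \<times> {..y})"
        by (rule AE_I') auto
    qed (use b in auto)
    also have "\<dots> = ennreal (C x y)"
      using M(5)[OF xy] by (simp add: emeasure_eq_measure)
    finally show ?thesis .
  qed
  ultimately show ?thesis by blast
qed

lemma copula_measure:
  assumes "copula C"
  shows sets_copula_measure: "sets (copula_measure C) = sets unit_square"
    and emeasure_copula_measure: "x \<in> {0..1} \<Longrightarrow> y \<in> {0..1} \<Longrightarrow>
           emeasure (copula_measure C) ({0..x} \<times> {0..y}) = ennreal (C x y)"
proof -
  have "\<exists>!\<mu>. sets \<mu> = sets unit_square \<and>
    (\<forall>x\<in>{0..1}. \<forall>y\<in>{0..1}. emeasure \<mu> ({0..x} \<times> {0..y}) = ennreal (C x y))"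
    using copula_measure_exists[OF assms] by (blast intro: copula_measure_unique)
  from theI'[OF this]
  show "sets (copula_measure C) = sets unit_square"
    and "x \<in> {0..1} \<Longrightarrow> y \<in> {0..1} \<Longrightarrow>
           emeasure (copula_measure C) ({0..x} \<times> {0..y}) = ennreal (C x y)"
    unfolding copula_measure_def by blast+
qed

end

theory Submission
  imports Defs
begin

text \<open>
  Put \<open>T(x, y) = ln x / ln (x y)\<close> and let \<open>H\<close> be the distribution function of \<open>\<theta>\<close>, so that
  \<open>A' = 2 H - 1\<close> off a countable set. For almost every \<open>x\<close> the kernel is
  \<open>K(x, [0, y]) = C(x, y) / x * g(T(x, y))\<close> with \<open>g(t) = A(t) + (1 - t) A'(t)\<close>. Both factors
  increase in \<open>y\<close>, and each increment bounds \<open>K(x, (a, b])\<close> from below: the increment of \<open>g\<close> by a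
  multiple of \<open>\<theta> ((T(x, a), T(x, b)])\<close>, the increment of \<open>C\<close>, when \<open>L = 0\<close> and \<open>R = 1\<close>, by a multiple
  of \<open>b - a\<close>. Hence, locally, \<open>K(x, \<cdot>)\<close> charges every Borel set that is charged by the image of \<open>\<theta>\<close>
  under the inverse of the diffeomorphism \<open>T(x, \<cdot>)\<close> (respectively, by Lebesgue measure). Atoms of
  \<open>\<theta>\<close> become atoms of \<open>K(x, \<cdot>)\<close>; the image of a Lebesgue null set carrying \<open>\<theta>sing\<close>, minus the atoms of \<open>K(x, \<cdot>)\<close>, can be charged only by
  the singular part of the kernel; and an interval without the null sets carrying the other two
  parts can be charged only by the absolutely continuous part.
\<close>

section \<open>Countable exceptional sets and comparison of measures\<close>

text \<open>
  If \<open>D b < D a\<close>, then \<open>E x = D x + e * (x - a)\<close> still satisfies \<open>E b < E a\<close> for a small \<open>e > 0\<close>. At the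
  last point where \<open>E\<close> attains a value in between that it does not attain on \<open>S\<close>, its derivative is
  positive, although \<open>E\<close> stays below that value afterwards.
\<close>

lemma nondecreasing_off_countable:
  fixes D :: "real \<Rightarrow> real"
  assumes ab: "a \<le> b" and cont: "continuous_on {a..b} D" and S: "countable S"
    and deriv: "\<And>x. x \<in> {a<..<b} - S \<Longrightarrow> \<exists>d\<ge>0. (D has_real_derivative d) (at x)"
  shows "D a \<le> D b"
proof (rule ccontr)
  assume "\<not> D a \<le> D b"
  then have less: "D b < D a" by simp
  with ab have ab': "a < b" by (cases "a = b") auto
  define e where "e = (D a - D b) / (2 * (b - a))"
  have e: "e > 0" using less ab' by (simp add: e_def)
  define E where "E x = D x + e * (x - a)" for x
  have contE: "continuous_on {a..b} E"
    unfolding E_def by (intro continuous_intros cont)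
  have "e * (b - a) = (D a - D b) / 2" unfolding e_def times_divide_eq_left
    using ab' by (subst nonzero_divide_eq_eq) auto
  then have "E b < E a" using less by (simp add: E_def)
  then have "uncountable {E b<..<E a}" by (simp add: uncountable_open_interval)
  moreover have "countable (E ` S)" using S by simp
  ultimately have "\<not> {E b<..<E a} \<subseteq> E ` S" by (metis countable_subset)
  then obtain c where "c \<in> {E b<..<E a}" and cS: "c \<notin> E ` S" by blast
  then have c: "E b < c" "c < E a" by simp_all
  define Z where "Z = {x \<in> {a..b}. c \<le> E x}"
  have "closed Z" unfolding Z_def
    using continuous_closed_preimage[OF contE closed_real_atLeastAtMost, of "{c..}"]
    unfolding vimage_def Int_def by simp
  then have "compact Z"
    unfolding compact_eq_bounded_closed by (auto simp: Z_def intro: bounded_subset[of "{a..b}"])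
  moreover have "a \<in> Z" using c ab by (auto simp: Z_def)
  ultimately obtain s where s: "s \<in> Z" and max: "\<And>x. x \<in> Z \<Longrightarrow> x \<le> s"
    using compact_attains_sup[of Z] by blast
  have sb: "s < b" using s c by (cases "s = b") (auto simp: Z_def)
  have "E s = c"
  proof (rule ccontr)
    assume "E s \<noteq> c"
    with s have "c < E s" by (auto simp: Z_def)
    moreover have "continuous_on {s..b} E"
      using contE by (rule continuous_on_subset) (use s in \<open>auto simp: Z_def\<close>)
    ultimately obtain x where x: "s \<le> x" "x \<le> b" "E x = c"
      using IVT2'[of E b c s] c sb by auto
    with s have "x \<in> Z" by (auto simp: Z_def)
    with max x have "x = s" by force
    with x \<open>c < E s\<close> show False by simp
  qed
  moreover from this have "s \<noteq> a" using c by blast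
  moreover have "s \<notin> S" using cS \<open>E s = c\<close> by blast
  ultimately have sS: "s \<in> {a<..<b} - S" using s sb by (auto simp: Z_def)
  then obtain d where d: "d \<ge> 0" "(D has_real_derivative d) (at s)" using deriv by blast
  have "(E has_real_derivative d + e) (at s)"
    unfolding E_def by (auto intro!: derivative_eq_intros d)
  then obtain h where h: "h > 0" "\<And>k. k > 0 \<Longrightarrow> k < h \<Longrightarrow> E s < E (s + k)"
    using DERIV_pos_inc_right[of E "d + e" s] d e by auto
  define k where "k = min (h / 2) (b - s)"
  have k: "0 < k" "k < h" "s + k \<le> b" using h sb by (auto simp: k_def)
  then have "s + k \<in> Z" using h(2)[OF k(1,2)] \<open>E s = c\<close> sS by (auto simp: Z_def)
  with max k show False by force
qed

text \<open>\<open>F\<close> minus the indefinite integral of \<open>f\<close> has derivative 0 off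
  \<open>S\<close>, continuity of \<open>f\<close> there giving the derivative of the integral.
  Applying \<open>nondecreasing_off_countable\<close> to this difference and to its negative shows
  that it agrees at \<open>a\<close> and \<open>b\<close>.\<close>

lemma fundamental_theorem_of_calculus_off_countable:
  fixes F f :: "real \<Rightarrow> real"
  assumes ab: "a \<le> b" and cont: "continuous_on {a..b} F" and S: "countable S"
    and deriv: "\<And>x. x \<in> {a<..<b} - S \<Longrightarrow> (F has_real_derivative f x) (at x)"
    and isc: "\<And>x. x \<in> {a<..<b} - S \<Longrightarrow> isCont f x"
    and int: "f integrable_on {a..b}"
  shows "(f has_integral F b - F a) {a..b}"
proof -
  define D where "D x = F x - integral {a..x} f" for x
  have contD: "continuous_on {a..b} D"
    unfolding D_def by (intro continuous_intros cont indefinite_integral_continuous_1 int)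
  have D0: "(D has_real_derivative 0) (at x)" if x: "x \<in> {a<..<b} - S" for x
  proof -
    have "((\<lambda>u. integral {a..u} f) has_vector_derivative f x) (at x within ({a..b} - {}))"
      using x isc[OF x] by (intro integral_has_vector_derivative_continuous_at int)
        (auto intro: continuous_at_imp_continuous_at_within)
    then have "((\<lambda>u. integral {a..u} f) has_real_derivative f x) (at x)"
      using x by (simp add: has_real_derivative_iff_has_vector_derivative at_within_Icc_at)
    from DERIV_diff[OF deriv[OF x] this] show ?thesis
      by (simp add: D_def[abs_def])
  qed
  have "D a \<le> D b"
    by (rule nondecreasing_off_countable[OF ab contD S]) (use D0 in blast)
  moreover have "- D a \<le> - D b"
    by (rule nondecreasing_off_countable[OF ab _ S])
      (use D0 contD in \<open>auto intro!: continuous_intros exI[of _ 0] derivative_eq_intros\<close>)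
  ultimately have "integral {a..b} f = F b - F a" by (simp add: D_def)
  with int show ?thesis by (metis integrable_integral)
qed

text \<open>Cut off outside \<open>{p<..q}\<close>, the two densities give measures that agree on
  the intersection-stable generator of half-open intervals and are finite on it; densities of equal
  measures agree almost everywhere.\<close>

lemma AE_eq_of_nn_integral_Ioc_eq:
  fixes f g :: "real \<Rightarrow> ennreal"
  assumes [measurable]: "f \<in> borel_measurable borel" "g \<in> borel_measurable borel"
    and pq: "p < q"
    and eq: "\<And>a b. p \<le> a \<Longrightarrow> a < b \<Longrightarrow> b \<le> q \<Longrightarrow>
      (\<integral>\<^sup>+x\<in>{a<..b}. f x \<partial>lborel) = (\<integral>\<^sup>+x\<in>{a<..b}. g x \<partial>lborel)"
    and fin: "(\<integral>\<^sup>+x\<in>{p<..q}. f x \<partial>lborel) < \<infinity>"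
  shows "AE x in lborel. x \<in> {p<..q} \<longrightarrow> f x = g x"
proof -
  let ?f = "\<lambda>x. f x * indicator {p<..q} x" and ?g = "\<lambda>x. g x * indicator {p<..q} x"
  have Ioc: "emeasure (density lborel (\<lambda>x. h x * indicator {p<..q} x)) {a<..b}
      = (\<integral>\<^sup>+x\<in>{max a p<..min b q}. h x \<partial>lborel)"
    if [measurable]: "h \<in> borel_measurable borel" for h :: "real \<Rightarrow> ennreal" and a b
    by (subst emeasure_density) (auto intro!: nn_integral_cong simp: indicator_def)
  have "density lborel ?f = density lborel ?g"
  proof (rule measure_eqI_generator_eq[where \<Omega> = UNIV and E = "range (\<lambda>(a, b). {a<..b::real})"
        and A = "\<lambda>n. {- real n<..real n}"])
    fix X assume "X \<in> range (\<lambda>(a, b). {a<..b::real})"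
    then obtain a b where X: "X = {a<..b}" by auto
    show "emeasure (density lborel ?f) X = emeasure (density lborel ?g) X"
    proof (cases "max a p < min b q")
      case True
      then show ?thesis unfolding X using eq[of "max a p" "min b q"] by (simp only: Ioc assms)
    next
      case False
      then have "{max a p<..min b q} = {}" by auto
      then show ?thesis unfolding X by (simp only: Ioc assms) simp
    qed
  next
    fix n :: nat
    have "emeasure (density lborel ?f) {- real n<..real n} \<le> (\<integral>\<^sup>+x\<in>{p<..q}. f x \<partial>lborel)"
      unfolding Ioc[OF assms(1)] by (intro nn_integral_mono) (auto simp: indicator_def)
    with fin show "emeasure (density lborel ?f) {- real n<..real n} \<noteq> \<infinity>"
      by (auto simp: top_unique)
  qed (auto simp: borel_sigma_sets_Ioc Int_stable_def UN_Ioc_eq_UNIV)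
  then have "AE x in lborel. ?f x = ?g x"
    by (intro sigma_finite_measure.density_unique sigma_finite_lborel) auto
  then show ?thesis
    by eventually_elim (auto simp: indicator_def split: if_splits)
qed

lemma rational_sequence_at_right:
  fixes x :: real
  obtains r :: "nat \<Rightarrow> real"
  where "\<And>n. r n \<in> \<rat>" "\<And>n. x < r n" "filterlim r (at_right x) sequentially"
proof -
  have "\<exists>r\<in>\<rat>. x < r \<and> r < x + inverse (real (Suc n))" for n
    by (rule Rats_dense_in_real) simp
  then obtain r where r: "\<And>n. r n \<in> \<rat>" "\<And>n. x < r n" "\<And>n. r n < x + inverse (real (Suc n))"
    by metis
  have "r \<longlonglongrightarrow> x"
  proof (rule tendsto_sandwich[of "\<lambda>_. x" r _ "\<lambda>n. x + inverse (real (Suc n))"])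
    show "(\<lambda>n. x + inverse (real (Suc n))) \<longlonglongrightarrow> x"
      using tendsto_add[OF tendsto_const LIMSEQ_inverse_real_of_nat, of x] by simp
  qed (use r(2,3) in \<open>auto intro!: always_eventually less_imp_le simp del: of_nat_Suc\<close>)
  then have "filterlim r (at_right x) sequentially"
    using r(2) by (simp add: filterlim_at less_imp_neq[symmetric])
  then show ?thesis using r that by blast
qed

text \<open>The difference of the two distribution functions generates the excess measure \<open>R\<close>.\<close>

lemma measure_mono_of_Ioc:
  assumes M: "finite_borel_measure M" and N: "finite_borel_measure N" and k: "0 \<le> k"
    and le: "\<And>a b. a \<in> \<rat> \<Longrightarrow> b \<in> \<rat> \<Longrightarrow> a < b \<Longrightarrow> k * measure N {a<..b} \<le> measure M {a<..b}"
    and B: "B \<in> sets borel"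
  shows "k * measure N B \<le> measure M B"
proof -
  interpret M: finite_borel_measure M by fact
  interpret N: finite_borel_measure N by fact
  define F where "F x = cdf M x - k * cdf N x" for x
  have rc: "continuous (at_right a) F" for a
    unfolding F_def by (intro continuous_intros M.cdf_is_right_cont N.cdf_is_right_cont)
  \<comment> \<open>The hypothesis speaks of rational endpoints only. Right continuity carries it to
    real \<open>x < y\<close> along rational sequences decreasing to each of them.\<close>
  have monoF: "F x \<le> F y" if "x \<le> y" for x y
  proof (cases "x = y")
    case False
    with that have "x < y" by simp
    obtain r where r: "\<And>n. r n \<in> \<rat>" "\<And>n. x < r n" "filterlim r (at_right x) sequentially"
      using rational_sequence_at_right[of x] by blast
    obtain s where s: "\<And>n. s n \<in> \<rat>" "\<And>n. y < s n" "filterlim s (at_right y) sequentially"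
      using rational_sequence_at_right[of y] by blast
    have "(\<lambda>n. F (s n)) \<longlonglongrightarrow> F y" "(\<lambda>n. F (r n)) \<longlonglongrightarrow> F x"
      using rc[of x] rc[of y] r(3) s(3) by (auto simp: continuous_within intro: filterlim_compose)
    moreover have "eventually (\<lambda>n. r n < y) sequentially"
      using r(3) \<open>x < y\<close> by (auto simp: filterlim_at intro: order_tendstoD)
    then have "eventually (\<lambda>n. F (r n) \<le> F (s n)) sequentially"
    proof eventually_elim
      case (elim n)
      then have "r n < s n" using s(2)[of n] by linarith
      then show ?case using le[OF r(1) s(1), of n n]
        by (simp add: F_def M.cdf_diff_eq[symmetric] N.cdf_diff_eq[symmetric] algebra_simps)
    qed
    ultimately show ?thesis
      by (rule tendsto_le[OF sequentially_bot])
  qed simp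
  have bot: "(F \<longlongrightarrow> 0) at_bot"
    unfolding F_def using tendsto_diff[OF M.cdf_lim_at_bot tendsto_mult[OF tendsto_const N.cdf_lim_at_bot, of k]]
    by simp
  \<comment> \<open>This is the total mass that the excess measure must have; the complement case of
    the induction below relies on it.\<close>
  define m where "m = measure M UNIV - k * measure N UNIV"
  have top: "(F \<longlongrightarrow> m) at_top"
    unfolding F_def m_def using tendsto_diff[OF M.cdf_lim_at_top tendsto_mult[OF tendsto_const N.cdf_lim_at_top, of k]]
    by (simp add: M.borel_UNIV N.borel_UNIV)
  have Fnn: "0 \<le> F x" for x
    using bot by (rule tendsto_upperbound)
      (auto simp: eventually_at_bot_linorder monoF intro!: exI[of _ x])
  have m: "0 \<le> m"
    using top by (rule tendsto_lowerbound) (auto simp: Fnn)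
  define R where "R = interval_measure F"
  interpret R: finite_borel_measure R
    unfolding R_def by (rule finite_borel_measure_interval_measure[OF monoF rc bot top m])
  have Rtop: "measure R UNIV = m"
    using interval_measure_UNIV[OF monoF rc bot top m] m by (simp add: R_def measure_def)
  have cdfR: "cdf R = F"
    unfolding R_def by (rule cdf_interval_measure[OF monoF rc bot])
  have "measure M B = k * measure N B + measure R B"
  proof -
    have "Int_stable (range (\<lambda>(a, b). {a<..b::real}))" by (auto simp: Int_stable_def)
    moreover have "range (\<lambda>(a, b). {a<..b::real}) \<subseteq> Pow UNIV" by simp
    moreover have "B \<in> sigma_sets UNIV (range (\<lambda>(a, b). {a<..b::real}))"
      using B by (simp add: borel_sigma_sets_Ioc)
    ultimately show ?thesis
    proof (induction rule: sigma_sets_induct_disjoint)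
      case (basic X)
      then obtain a b where X: "X = {a<..b}" by auto
      show ?case
      proof (cases "a < b")
        case True
        then show ?thesis unfolding X
          by (simp add: M.cdf_diff_eq[symmetric] N.cdf_diff_eq[symmetric] R.cdf_diff_eq[symmetric] cdfR F_def algebra_simps)
      qed (simp add: X)
    next
      case empty then show ?case by simp
    next
      case (compl X)
      then have [measurable]: "X \<in> sets borel" by (simp add: borel_sigma_sets_Ioc)
      have "measure M (UNIV - X) = measure M UNIV - measure M X"
        using M.finite_measure_compl[of X] by (simp add: M.borel_UNIV M.sets_M)
      moreover have "measure N (UNIV - X) = measure N UNIV - measure N X"
        using N.finite_measure_compl[of X] by (simp add: N.borel_UNIV N.sets_M)
      moreover have "measure R (UNIV - X) = measure R UNIV - measure R X"
        using R.finite_measure_compl[of X] by (simp add: R.borel_UNIV R.sets_M)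
      ultimately show ?case using compl by (simp add: Rtop m_def right_diff_distrib)
    next
      case (union X)
      then have X: "range X \<subseteq> sets borel" by (simp add: borel_sigma_sets_Ioc)
      have "(\<lambda>i. measure M (X i)) sums measure M (\<Union>i. X i)"
        using X union M.M_is_borel by (intro M.finite_measure_UNION) auto
      moreover have "(\<lambda>i. k * measure N (X i) + measure R (X i)) sums
          (k * measure N (\<Union>i. X i) + measure R (\<Union>i. X i))"
        using X union N.M_is_borel R.M_is_borel
        by (intro sums_add sums_mult N.finite_measure_UNION R.finite_measure_UNION) auto
      ultimately show ?case using union by (simp add: sums_unique2)
    qed
  qed
  then show ?thesis by simp
qed

text \<open>Restrict both measures to \<open>{c<..d}\<close>. As \<open>c\<close> and
  \<open>d\<close> are rational, a rational interval meets \<open>{c<..d}\<close> in a rational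
  interval or not at all, so \<open>measure_mono_of_Ioc\<close> applies to the restrictions.\<close>

lemma measure_mono_of_Ioc_within:
  assumes M: "finite_borel_measure M" and N: "finite_borel_measure N" and k: "0 \<le> k"
    and cd: "c \<in> \<rat>" "d \<in> \<rat>"
    and le: "\<And>a b. a \<in> \<rat> \<Longrightarrow> b \<in> \<rat> \<Longrightarrow> c \<le> a \<Longrightarrow> a < b \<Longrightarrow> b \<le> d \<Longrightarrow>
      k * measure N {a<..b} \<le> measure M {a<..b}"
    and B: "B \<in> sets borel" "B \<subseteq> {c<..d}"
  shows "k * measure N B \<le> measure M B"
proof -
  let ?r = "\<lambda>M. density M (indicator {c<..d})"
  have r: "finite_borel_measure (?r M) \<and> (\<forall>X\<in>sets borel. measure (?r M) X = measure M ({c<..d} \<inter> X))"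
    if "finite_borel_measure M" for M
  proof -
    interpret M: finite_borel_measure M by fact
    have 1: "emeasure (?r M) X = emeasure M ({c<..d} \<inter> X)" if "X \<in> sets borel" for X
      using that by (intro emeasure_restricted) auto
    have "finite_measure (?r M)"
      using 1[of UNIV] by (intro finite_measureI) (simp add: M.borel_UNIV)
    then interpret r: finite_measure "?r M" .
    have "finite_borel_measure (?r M)" by standard (simp add: M.M_is_borel)
    then show ?thesis using 1 by (simp add: measure_def)
  qed
  have "k * measure (?r N) B \<le> measure (?r M) B"
  proof (rule measure_mono_of_Ioc[OF _ _ k _ B(1)])
    show "k * measure (?r N) {a<..b} \<le> measure (?r M) {a<..b}" if "a \<in> \<rat>" "b \<in> \<rat>" "a < b" for a b
    proof -
      have I: "{c<..d} \<inter> {a<..b} = {max c a<..min d b}" by auto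
      show ?thesis
      proof (cases "max c a < min d b")
        case True
        then show ?thesis using r[OF M] r[OF N] le[of "max c a" "min d b"] that cd
          by (simp add: I max_def min_def)
      next
        case False
        then have E: "{c<..d} \<inter> {a<..b} = {}" by auto
        have "measure (?r M) {a<..b} = 0" if "finite_borel_measure M" for M
          using r[OF that, THEN conjunct2, THEN bspec, of "{a<..b}"] unfolding E by simp
        then show ?thesis using M N by simp
      qed
    qed
  qed (use r M N in auto)
  moreover have "{c<..d} \<inter> B = B" using B by auto
  ultimately show ?thesis using r[OF M] r[OF N] B by simp
qed


section \<open>Pickands dependence functions\<close>

text \<open>Pushing a measure on the unit interval forward to the real line makes distribution
  functions (\<open>cdf\<close>) and \<open>finite_borel_measure\<close> available for it.\<close>

definition borel_extension :: "real measure \<Rightarrow> real measure" where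
  "borel_extension M = distr M borel (\<lambda>x. x)"

lemma sets_borel_extension [simp, measurable_cong]: "sets (borel_extension M) = sets borel"
  by (simp add: borel_extension_def)

lemma measurable_ident_unit_lebesgue:
  assumes "sets M = sets unit_lebesgue"
  shows "(\<lambda>x. x) \<in> M \<rightarrow>\<^sub>M borel"
  unfolding measurable_cong_sets[OF assms refl] measurable_cong_sets[OF sets_unit_lebesgue refl]
  by (rule measurable_restrict_space1) simp

lemma sets_unit_lebesgue_iff:
  "B \<in> sets unit_lebesgue \<longleftrightarrow> B \<in> sets borel \<and> B \<subseteq> {0..1}"
  unfolding sets_unit_lebesgue by (auto simp: sets_restrict_space_iff)

lemma emeasure_borel_extension:
  assumes "sets M = sets unit_lebesgue" and "B \<in> sets borel"
  shows "emeasure (borel_extension M) B = emeasure M (B \<inter> {0..1})"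
proof -
  have "space M = {0..1}" using sets_eq_imp_space_eq[OF assms(1)] by simp
  then show ?thesis
    unfolding borel_extension_def
    by (subst emeasure_distr[OF measurable_ident_unit_lebesgue[OF assms(1)] assms(2)]) simp
qed

lemma measure_borel_extension:
  assumes "sets M = sets unit_lebesgue" and "B \<in> sets borel"
  shows "measure (borel_extension M) B = measure M (B \<inter> {0..1})"
  using emeasure_borel_extension[OF assms] by (simp add: measure_def)

lemma finite_borel_measure_borel_extension:
  assumes "sets M = sets unit_lebesgue" and "finite_measure M"
  shows "finite_borel_measure (borel_extension M)"
proof -
  interpret finite_measure M by fact
  interpret B: finite_measure "borel_extension M"
    unfolding borel_extension_def
    by (rule finite_measure_distr[OF measurable_ident_unit_lebesgue[OF assms(1)]])
  show ?thesis by standard simp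
qed

section \<open>The distribution function of the dependence measure, and the functions
  \<open>g\<close> and \<open>m\<close>\<close>

locale pickands_pair =
  fixes A :: "real \<Rightarrow> real" and \<theta> :: "real measure"
  assumes pm: "pickands_measure \<theta>" and pf: "pickands_function A"
    and fn: "function_of_pickands_measure A \<theta>"
begin

lemma sets_theta: "sets \<theta> = sets unit_lebesgue"
  using pm by (simp add: pickands_measure_def)

sublocale theta: prob_space \<theta>
  using pm by (simp add: pickands_measure_def)

sublocale ext: finite_borel_measure "borel_extension \<theta>"
  by (rule finite_borel_measure_borel_extension[OF sets_theta theta.finite_measure_axioms])

definition H :: "real \<Rightarrow> real" where "H = cdf (borel_extension \<theta>)"

lemma H_eq: "H t = measure \<theta> ({..t} \<inter> {0..1})"
  by (simp add: H_def cdf_def measure_borel_extension[OF sets_theta])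

lemma H_mono: "s \<le> t \<Longrightarrow> H s \<le> H t"
  unfolding H_def by (rule ext.cdf_nondecreasing)

lemma H_nonneg: "0 \<le> H t" by (simp add: H_eq)

lemma H_le_1: "H t \<le> 1" by (simp add: H_eq)

lemma measurable_H [measurable]: "H \<in> borel_measurable borel"
  by (rule borel_measurable_mono) (simp add: mono_def H_mono)

lemma H_integrable: "H integrable_on {a..b}"
  by (rule integrable_on_mono_on) (auto simp: mono_on_def H_mono)

text \<open>On \<open>{0..t}\<close> the mass of \<open>{0..z}\<close> is \<open>H z\<close>, and
  the Lebesgue integral is rewritten as a gauge integral, for which the differentiation theorems are
  used.\<close>

lemma A_eq:
  assumes t: "t \<in> {0..1}"
  shows "A t = 1 - t + 2 * integral {0..t} H"
proof -
  have int: "set_integrable lborel {0..t} H"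
    unfolding set_integrable_def
    by (rule integrableI_bounded_set_indicator[where B = 1])
      (auto simp: H_nonneg H_le_1 emeasure_lborel_Icc_eq)
  have "(\<integral>z\<in>{0..t}. measure \<theta> {0..z} \<partial>unit_lebesgue)
      = (\<integral>z. indicator {0..1} z *\<^sub>R (indicator {0..t} z *\<^sub>R measure \<theta> {0..z}) \<partial>lborel)"
    unfolding set_lebesgue_integral_def unit_lebesgue_def
    by (subst integral_restrict_space) auto
  also have "\<dots> = (\<integral>z\<in>{0..t}. H z \<partial>lborel)"
    unfolding set_lebesgue_integral_def
  proof (rule Bochner_Integration.integral_cong[OF refl])
    fix z :: real
    show "indicator {0..1} z *\<^sub>R (indicator {0..t} z *\<^sub>R measure \<theta> {0..z}) = indicator {0..t} z *\<^sub>R H z"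
    proof (cases "z \<in> {0..t}")
      case True
      then have "{..z} \<inter> {0..1} = {0..z}" using t by auto
      then show ?thesis using True t by (simp add: H_eq)
    qed simp
  qed
  also have "\<dots> = integral {0..t} H"
    by (rule set_borel_integral_eq_integral(2)[OF int])
  finally show ?thesis using fn t by (simp add: function_of_pickands_measure_def)
qed

lemma A_bounds:
  assumes "t \<in> {0..1}"
  shows "t \<le> A t" "1 - t \<le> A t" "A t \<le> 1"
  using pf assms by (auto simp: pickands_function_def)

lemma A_continuous: "continuous_on {0..1} A"
proof -
  have "continuous_on {0..1} (\<lambda>t. 1 - t + 2 * integral {0..t} H)"
    by (intro continuous_intros indefinite_integral_continuous_1 H_integrable)
  then show ?thesis by (rule continuous_on_eq) (simp add: A_eq)
qed

lemma A_has_derivative: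
  assumes t: "t \<in> {0<..<1}" and c: "isCont H t"
  shows "(A has_real_derivative 2 * H t - 1) (at t)"
proof -
  have "((\<lambda>u. integral {0..u} H) has_vector_derivative H t) (at t within ({0..1} - {}))"
    using t c by (intro integral_has_vector_derivative_continuous_at H_integrable)
      (auto intro: continuous_at_imp_continuous_at_within)
  then have "((\<lambda>u. integral {0..u} H) has_real_derivative H t) (at t)"
    using t by (simp add: has_real_derivative_iff_has_vector_derivative at_within_Icc_at)
  then have "((\<lambda>t. 1 - t + 2 * integral {0..t} H) has_real_derivative 2 * H t - 1) (at t)"
    by (auto intro!: derivative_eq_intros)
  then show ?thesis
    by (rule has_field_derivative_transform_within_open[where S = "{0<..<1}"])
      (use t in \<open>auto simp: A_eq\<close>)
qed

text \<open>Writing \<open>2 * H t - 1\<close>, the right derivative of \<open>A\<close>, in place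
  of \<open>A'\<close> gives \<open>g\<close> a value also at the kinks of \<open>A\<close>.\<close>

definition g :: "real \<Rightarrow> real" where "g t = A t + (1 - t) * (2 * H t - 1)"

lemma g_eq:
  assumes "t \<in> {0..1}"
  shows "g t = 2 * integral {0..t} H + 2 * (1 - t) * H t"
  by (simp add: g_def A_eq[OF assms] algebra_simps)

text \<open>The integral term in \<open>g_eq\<close> is exactly \<open>A t - (1 - t)\<close>, and
  the other term is nonnegative. This makes \<open>g\<close> positive wherever \<open>A\<close> lies
  strictly above \<open>1 - t\<close>.\<close>

lemma g_ge:
  assumes "t \<in> {0..1}"
  shows "A t - (1 - t) \<le> g t"
  using assms H_nonneg[of t] by (simp add: g_eq A_eq)

lemma g_nonneg: "t \<in> {0..1} \<Longrightarrow> 0 \<le> g t"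
  using g_ge[of t] A_bounds(2)[of t] by simp

lemma g_le: "t \<in> {0..1} \<Longrightarrow> g t \<le> 2"
proof -
  assume t: "t \<in> {0..1}"
  have "(1 - t) * (2 * H t - 1) \<le> (1 - t) * 1"
    using t H_le_1[of t] by (intro mult_left_mono) auto
  then show ?thesis unfolding g_def using A_bounds(3)[OF t] t by simp
qed

text \<open>Between \<open>a\<close> and \<open>b\<close> the integral of \<open>H\<close> is at
  least \<open>(b - a) * H a\<close>. Inserted into \<open>g_eq\<close>, this leaves
  \<open>H a\<close> with the coefficient \<open>-2 * (1 - b)\<close>, opposite to that of
  \<open>H b\<close>.\<close>

lemma g_diff_ge:
  assumes "0 \<le> a" "a \<le> b" "b \<le> 1"
  shows "2 * (1 - b) * (H b - H a) \<le> g b - g a"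
proof -
  have "integral {0..b} H = integral {0..a} H + integral {a..b} H"
    using assms by (intro Henstock_Kurzweil_Integration.integral_combine[symmetric] H_integrable) auto
  moreover have "(b - a) * H a \<le> integral {a..b} H"
    using integral_le[of "\<lambda>_. H a" "{a..b}" H] assms by (auto simp: H_integrable H_mono)
  ultimately show ?thesis using assms by (simp add: g_eq algebra_simps)
qed

lemma g_mono:
  assumes "0 \<le> a" "a \<le> b" "b \<le> 1"
  shows "g a \<le> g b"
proof -
  have "0 \<le> 2 * (1 - b) * (H b - H a)" using H_mono[of a b] assms by simp
  with g_diff_ge[OF assms] show ?thesis by linarith
qed

text \<open>\<open>C(x, y) = x * y powr m (T(x, y))\<close>; the slope \<open>1 - m\<close> of \<open>A\<close> towards \<open>1\<close> is monotone by convexity.\<close>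

definition m :: "real \<Rightarrow> real" where "m t = (A t - t) / (1 - t)"

lemma m_nonneg: "t \<in> {0..<1} \<Longrightarrow> 0 \<le> m t"
  using A_bounds(1)[of t] by (simp add: m_def)

lemma m_le_1: "t \<in> {0..<1} \<Longrightarrow> m t \<le> 1"
  using A_bounds(3)[of t] by (simp add: m_def)

lemma A_1: "A 1 = 1" using A_bounds[of 1] by simp

lemma m_antimono:
  assumes "0 \<le> s" "s \<le> t" "t < 1"
  shows "m t \<le> m s"
proof (cases "s = t")
  case False
  have "convex_on {0..1} A" using pf by (simp add: pickands_function_def)
  then have "(A s - A 1) / (s - 1) \<le> (A t - A 1) / (t - 1)"
    using assms False by (intro convex_on_slope_le(2)[where t = t]) auto
  moreover have "m u = 1 - (A u - A 1) / (u - 1)" if "u < 1" for u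
    using that by (simp add: m_def A_1 field_simps)
  ultimately show ?thesis using assms by simp
qed simp

end


section \<open>The partial derivative of the copula\<close>

definition pick_arg :: "real \<Rightarrow> real \<Rightarrow> real" where
  "pick_arg x y = ln x / ln (x * y)"

lemma ln_mult_neg:
  fixes x y :: real
  assumes "x \<in> {0<..<1}" "y \<in> {0<..<1}"
  shows "ln (x * y) = ln x + ln y" "ln x < 0" "ln y < 0" "ln (x * y) < 0"
proof -
  show 1: "ln (x * y) = ln x + ln y" "ln x < 0" "ln y < 0" using assms by (auto simp: ln_mult)
  then show "ln (x * y) < 0" by linarith
qed

lemma one_minus_pick_arg:
  assumes "x \<in> {0<..<1}" "y \<in> {0<..<1}"
  shows "1 - pick_arg x y = ln y / ln (x * y)"
  using ln_mult_neg[OF assms] by (simp add: pick_arg_def field_simps)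

lemma pick_arg_in:
  assumes "x \<in> {0<..<1}" "y \<in> {0<..<1}"
  shows "pick_arg x y \<in> {0<..<1}"
proof -
  have "0 < pick_arg x y" using ln_mult_neg[OF assms] by (simp add: pick_arg_def divide_neg_neg)
  moreover have "0 < 1 - pick_arg x y"
    unfolding one_minus_pick_arg[OF assms] using ln_mult_neg[OF assms] by (simp add: divide_neg_neg)
  ultimately show ?thesis by simp
qed

lemma pick_arg_strict_mono:
  assumes "x \<in> {0<..<1}" "0 < a" "a < b" "b < 1"
  shows "pick_arg x a < pick_arg x b"
proof -
  have a: "a \<in> {0<..<1}" and b: "b \<in> {0<..<1}" using assms by auto
  note A = ln_mult_neg[OF assms(1) a] and B = ln_mult_neg[OF assms(1) b]
  have "ln a < ln b" using assms by simp
  then have "ln x * ln b < ln x * ln a" using A by simp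
  then show ?thesis using A B
    by (simp add: pick_arg_def A(1) B(1) divide_less_eq less_divide_eq mult_less_0_iff field_simps)
qed

text \<open>Injectivity in \<open>x\<close> is what lets the countably many jumps of
  \<open>H\<close> pull back to countably many exceptional \<open>x\<close>.\<close>

lemma pick_arg_strict_antimono:
  assumes "y \<in> {0<..<1}" "0 < a" "a < b" "b < 1"
  shows "pick_arg b y < pick_arg a y"
proof -
  have a: "a \<in> {0<..<1}" and b: "b \<in> {0<..<1}" using assms by auto
  note A = ln_mult_neg[OF a assms(1)] and B = ln_mult_neg[OF b assms(1)]
  have "ln a < ln b" using assms by simp
  then have "ln y * ln b < ln y * ln a" using A by simp
  then show ?thesis using A B
    by (simp add: pick_arg_def A(1) B(1) divide_less_eq less_divide_eq mult_less_0_iff field_simps)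
qed

lemma measurable_pick_arg [measurable]: "pick_arg x \<in> borel_measurable borel"
  unfolding pick_arg_def by measurable

lemma measurable_pick_arg' [measurable]: "(\<lambda>x. pick_arg x y) \<in> borel_measurable borel"
  unfolding pick_arg_def by measurable

lemma pick_arg_has_derivative:
  assumes x: "x \<in> {0<..<1}" and y: "y \<in> {0<..<1}"
  shows "((\<lambda>x. pick_arg x y) has_real_derivative (1 - pick_arg x y) / (x * ln (x * y))) (at x)"
proof -
  note A = ln_mult_neg[OF x y]
  have "((\<lambda>x. pick_arg x y) has_real_derivative
      ((1 / x) * ln (x * y) - ln x * (y / (x * y))) / (ln (x * y) * ln (x * y))) (at x)"
    unfolding pick_arg_def using x y A by (auto intro!: derivative_eq_intros)
  moreover have "((1 / x) * ln (x * y) - ln x * (y / (x * y))) / (ln (x * y) * ln (x * y))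
      = (1 - pick_arg x y) / (x * ln (x * y))"
    unfolding one_minus_pick_arg[OF x y] using x y A by (simp add: field_simps)
  ultimately show ?thesis by simp
qed

lemma pick_arg_continuous:
  assumes y: "y \<in> {0<..<1}"
  shows "continuous_on {0<..<1} (\<lambda>x. pick_arg x y)"
  using pick_arg_has_derivative[OF _ y] by (intro continuous_at_imp_continuous_on ballI DERIV_isCont)

text \<open>This solves \<open>ln x / (ln x + ln y) = t\<close> for \<open>y\<close>, so it inverts
  \<open>pick_arg x\<close> on the open unit interval.\<close>

definition pick_inv :: "real \<Rightarrow> real \<Rightarrow> real" where
  "pick_inv x t = exp (ln x * (1 - t) / t)"

lemma pick_inv_in:
  assumes "x \<in> {0<..<1}" "t \<in> {0<..<1}"
  shows "pick_inv x t \<in> {0<..<1}"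
  using assms by (auto simp: pick_inv_def intro!: divide_neg_pos mult_neg_pos)

lemma pick_inv_pick_arg:
  assumes "x \<in> {0<..<1}" "y \<in> {0<..<1}"
  shows "pick_inv x (pick_arg x y) = y"
proof -
  note A = ln_mult_neg[OF assms]
  have "ln x * (1 - pick_arg x y) / pick_arg x y = ln y"
    unfolding one_minus_pick_arg[OF assms] using A(2,4) by (simp add: pick_arg_def)
  then show ?thesis using assms by (simp add: pick_inv_def)
qed

lemma pick_arg_pick_inv:
  assumes "x \<in> {0<..<1}" "t \<in> {0<..<1}"
  shows "pick_arg x (pick_inv x t) = t"
proof -
  have "ln (x * pick_inv x t) = ln x / t"
    using assms by (subst ln_mult) (auto simp: pick_inv_def field_simps)
  then show ?thesis using assms by (simp add: pick_arg_def)
qed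

text \<open>Differentiability is needed because differentiable maps send Lebesgue null sets to null
  sets.\<close>

lemma pick_inv_differentiable: "pick_inv x differentiable_on {0<..<1}"
proof -
  have "\<exists>D. (pick_inv x has_real_derivative D) (at t)" if "t \<in> {0<..<1}" for t
    unfolding pick_inv_def using that by (auto intro!: exI derivative_eq_intros)
  then show ?thesis
    unfolding differentiable_on_def
    by (metis differentiable_at_withinI real_differentiable_def)
qed

section \<open>The copula as a function of each variable and its derivative in the first\<close>

locale evc_pair = pickands_pair +
  fixes C :: "real \<Rightarrow> real \<Rightarrow> real"
  assumes cop: "copula C" and cpf: "copula_of_pickands_function C A"
begin

lemma C_powr:
  assumes "x \<in> {0<..<1}" "y \<in> {0<..<1}"
  shows "C x y = exp (ln (x * y) * A (pick_arg x y))"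
  using cpf assms by (auto simp: copula_of_pickands_function_def pick_arg_def powr_def mult.commute)

lemma C_pos: "x \<in> {0<..<1} \<Longrightarrow> y \<in> {0<..<1} \<Longrightarrow> 0 < C x y"
  by (simp add: C_powr)

lemma C_eq_m:
  assumes "x \<in> {0<..<1}" "y \<in> {0<..<1}"
  shows "C x y = x * y powr m (pick_arg x y)"
proof -
  note L = ln_mult_neg[OF assms]
  let ?T = "pick_arg x y"
  \<comment> \<open>The numbers \<open>ln x\<close> and \<open>ln y\<close> are the shares
    \<open>?T\<close> and \<open>1 - ?T\<close> of \<open>ln (x * y)\<close>, which splits the
    exponent.\<close>
  have "ln x = ln (x * y) * ?T" using L by (simp add: pick_arg_def)
  moreover have "ln y = ln (x * y) * (1 - ?T)" using L by (simp add: one_minus_pick_arg[OF assms])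
  moreover have "A ?T = ?T + (1 - ?T) * m ?T" using pick_arg_in[OF assms] by (simp add: m_def)
  then have "ln (x * y) * A ?T = ln (x * y) * ?T + ln (x * y) * (1 - ?T) * m ?T"
    by (simp only: distrib_left mult.assoc)
  ultimately have "ln (x * y) * A ?T = ln x + ln y * m ?T"
    by simp
  then show ?thesis using assms by (simp add: C_powr exp_add powr_def mult.commute)
qed

text \<open>Freeze the exponent at its value \<open>r\<close> at \<open>b\<close>. Since
  \<open>r\<close> is at most the exponent at \<open>a\<close> and \<open>a < 1\<close>, this can
  only raise the term at \<open>a\<close>. The mean value theorem for \<open>z powr r\<close> then
  gives slope at least \<open>r\<close>, because \<open>z powr (r - 1)\<close> is at least 1 for
  \<open>z < 1\<close> and \<open>r\<close> at most 1.\<close>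

lemma C_diff_ge:
  assumes x: "x \<in> {0<..<1}" and ab: "0 < a" "a \<le> b" "b < 1"
  shows "x * m (pick_arg x b) * (b - a) \<le> C x b - C x a"
proof (cases "a = b")
  case False
  have a: "a \<in> {0<..<1}" and b: "b \<in> {0<..<1}" using ab by auto
  define r where "r = m (pick_arg x b)"
  have r: "0 \<le> r" "r \<le> 1"
    using m_nonneg[of "pick_arg x b"] m_le_1[of "pick_arg x b"] pick_arg_in[OF x b] by (auto simp: r_def)
  have "r \<le> m (pick_arg x a)" unfolding r_def
    using pick_arg_in[OF x a] pick_arg_in[OF x b] pick_arg_strict_mono[OF x, of a b] ab False
    by (intro m_antimono) auto
  then have "a powr m (pick_arg x a) \<le> a powr r"
    using ab by (intro powr_mono') auto
  moreover have "r * (b - a) \<le> b powr r - a powr r"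
  proof -
    have "\<exists>z>a. z < b \<and> b powr r - a powr r = (b - a) * (r * z powr (r - 1))"
      using ab False by (intro MVT2) (auto intro!: derivative_eq_intros simp: field_simps)
    then obtain z where z: "a < z" "z < b" "b powr r - a powr r = (b - a) * (r * z powr (r - 1))" by auto
    have "1 powr (r - 1) \<le> z powr (r - 1)"
      using z ab r by (intro powr_mono2') auto
    then have "(b - a) * (r * 1) \<le> (b - a) * (r * z powr (r - 1))"
      using r ab by (intro mult_left_mono) auto
    then show ?thesis using z by (simp add: mult.commute)
  qed
  ultimately have "x * (r * (b - a)) \<le> x * (b powr r - a powr m (pick_arg x a))"
    using x by (intro mult_left_mono) auto
  then show ?thesis
    by (simp add: C_eq_m[OF x a] C_eq_m[OF x b] r_def[symmetric] algebra_simps)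
qed simp

lemma C_mono:
  assumes x: "x \<in> {0<..<1}" and ab: "0 < a" "a \<le> b" "b < 1"
  shows "C x a \<le> C x b"
proof -
  have "b \<in> {0<..<1}" using ab by simp
  from pick_arg_in[OF x this] have "0 \<le> x * m (pick_arg x b) * (b - a)"
    using x ab m_nonneg[of "pick_arg x b"] by simp
  with C_diff_ge[OF assms] show ?thesis by linarith
qed

text \<open>The derivative of \<open>C\<close> in its first variable wherever \<open>H\<close> is
  continuous at \<open>pick_arg x y\<close>; at the remaining points the same formula fixes a
  value.\<close>

definition dC :: "real \<Rightarrow> real \<Rightarrow> real" where
  "dC x y = C x y / x * g (pick_arg x y)"

lemma dC_nonneg:
  assumes "x \<in> {0<..<1}" "y \<in> {0<..<1}"
  shows "0 \<le> dC x y"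
  using C_pos[OF assms] g_nonneg[of "pick_arg x y"] pick_arg_in[OF assms] assms
  by (auto simp: dC_def)

lemma isCont_A: "t \<in> {0<..<1} \<Longrightarrow> isCont A t"
  using A_continuous by (metis continuous_on_interior interior_atLeastAtMost_real)

lemma C_continuous:
  assumes y: "y \<in> {0<..<1}"
  shows "continuous_on {0<..<1} (\<lambda>x. C x y)"
proof -
  have "continuous_on {0<..<1} (\<lambda>x. exp (ln (x * y) * A (pick_arg x y)))"
    using y pick_arg_in[OF _ y]
    by (intro continuous_intros pick_arg_continuous[OF y] continuous_on_compose2[OF A_continuous])
      fastforce+
  then show ?thesis by (rule continuous_on_eq) (use y in \<open>auto simp: C_powr\<close>)
qed

lemma C_has_derivative:
  assumes x: "x \<in> {0<..<1}" and y: "y \<in> {0<..<1}" and c: "isCont H (pick_arg x y)"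
  shows "((\<lambda>x. C x y) has_real_derivative dC x y) (at x)"
proof -
  let ?T = "pick_arg x y"
  have A': "((\<lambda>x. A (pick_arg x y)) has_real_derivative
      (2 * H ?T - 1) * ((1 - ?T) / (x * ln (x * y)))) (at x)"
    using DERIV_chain2[OF A_has_derivative[OF pick_arg_in[OF x y] c] pick_arg_has_derivative[OF x y]] .
  have "((\<lambda>x. exp (ln (x * y) * A (pick_arg x y))) has_real_derivative
      exp (ln (x * y) * A ?T) * (1 / x * A ?T + ln (x * y) * ((2 * H ?T - 1) * ((1 - ?T) / (x * ln (x * y)))))) (at x)"
    using x y ln_mult_neg(4)[OF x y] by (auto intro!: derivative_eq_intros A')
  \<comment> \<open>The factor \<open>ln (x * y)\<close> cancels against the denominator in the
    derivative of \<open>pick_arg\<close>, leaving \<open>g ?T / x\<close>.\<close>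
  also have "exp (ln (x * y) * A ?T) * (1 / x * A ?T + ln (x * y) * ((2 * H ?T - 1) * ((1 - ?T) / (x * ln (x * y))))) = dC x y"
  proof -
    have "ln (x * y) * ((2 * H ?T - 1) * ((1 - ?T) / (x * ln (x * y)))) = (1 - ?T) * (2 * H ?T - 1) / x"
      using ln_mult_neg(4)[OF x y] by simp
    then show ?thesis
      unfolding dC_def C_powr[OF x y] g_def by (simp add: add_divide_distrib distrib_left)
  qed
  finally show ?thesis
    by (rule has_field_derivative_transform_within_open[where S = "{0<..<1}"])
      (use x y in \<open>auto simp: C_powr\<close>)
qed

lemma dC_isCont:
  assumes x: "x \<in> {0<..<1}" and y: "y \<in> {0<..<1}" and c: "isCont H (pick_arg x y)"
  shows "isCont (\<lambda>x. dC x y) x"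
proof -
  have g: "isCont g (pick_arg x y)"
    unfolding g_def using pick_arg_in[OF x y] by (intro continuous_intros isCont_A c)
  have "isCont (\<lambda>x. pick_arg x y) x"
    using pick_arg_has_derivative[OF x y] by (rule DERIV_isCont)
  then have "isCont (\<lambda>x. g (pick_arg x y)) x" using g by (rule isCont_o2)
  moreover have "isCont (\<lambda>x. C x y) x"
    using C_continuous[OF y] x by (simp add: continuous_on_eq_continuous_at)
  ultimately show ?thesis
    unfolding dC_def using x by (intro continuous_intros) auto
qed

lemma dC_measurable:
  assumes y: "y \<in> {0<..<1}"
  shows "(\<lambda>x. dC x y) \<in> borel_measurable (restrict_space borel {0<..<1})"
proof -
  have A: "(\<lambda>x. A (pick_arg x y)) \<in> borel_measurable (restrict_space borel {0<..<1})"
    using pick_arg_in[OF _ y]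
    by (intro borel_measurable_continuous_on_restrict continuous_on_compose2[OF A_continuous]
       pick_arg_continuous[OF y]) fastforce
  have H: "(\<lambda>x. H (pick_arg x y)) \<in> borel_measurable (restrict_space borel {0<..<1})"
    by (intro measurable_restrict_space1) measurable
  have T: "(\<lambda>x. pick_arg x y) \<in> borel_measurable (restrict_space borel {0<..<1})"
    by (intro measurable_restrict_space1) measurable
  have C: "(\<lambda>x. C x y) \<in> borel_measurable (restrict_space borel {0<..<1})"
    by (intro borel_measurable_continuous_on_restrict C_continuous y)
  have I: "(\<lambda>x. x) \<in> borel_measurable (restrict_space borel {0::real<..<1})"
    by (intro measurable_restrict_space1) measurable
  show ?thesis unfolding dC_def g_def
    by (intro borel_measurable_times borel_measurable_divide borel_measurable_add
      borel_measurable_diff borel_measurable_const A H T C I)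
qed

text \<open>For fixed \<open>y\<close> the derivative formula can fail only where
  \<open>pick_arg x y\<close> hits a discontinuity of the monotone \<open>H\<close>, hence only for
  countably many \<open>x\<close>.\<close>

lemma dC_has_integral:
  assumes y: "y \<in> {0<..<1}" and ab: "0 < a" "a \<le> b" "b < 1"
  shows "((\<lambda>x. dC x y) has_integral C b y - C a y) {a..b}"
proof (rule fundamental_theorem_of_calculus_off_countable)
  define S where "S = {x \<in> {0<..<1}. \<not> isCont H (pick_arg x y)}"
  have sub: "{a..b} \<subseteq> {0<..<1}" using ab by auto
  have "(\<lambda>x. pick_arg x y) ` S \<subseteq> {t. \<not> isCont H t}" by (auto simp: S_def)
  moreover have "countable {t. \<not> isCont H t}"
    by (rule mono_ctble_discont) (simp add: mono_def H_mono)
  ultimately have "countable ((\<lambda>x. pick_arg x y) ` S)" by (rule countable_subset)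
  moreover have "inj_on (\<lambda>x. pick_arg x y) S"
  proof (rule linorder_inj_onI)
    fix u v assume "u < v" "u \<in> S" "v \<in> S"
    then show "pick_arg u y \<noteq> pick_arg v y"
      using pick_arg_strict_antimono[OF y, of u v] by (simp add: S_def)
  qed auto
  ultimately show "countable S" by (rule countable_image_inj_on)
  show "continuous_on {a..b} (\<lambda>x. C x y)"
    using C_continuous[OF y] sub by (rule continuous_on_subset)
  show "((\<lambda>x. C x y) has_real_derivative dC x y) (at x)" "isCont (\<lambda>x. dC x y) x"
    if "x \<in> {a<..<b} - S" for x
    using that ab y by (auto simp: S_def intro!: C_has_derivative dC_isCont)
  show "a \<le> b" by fact
  \<comment> \<open>Integrability comes from boundedness: \<open>C x y / x\<close> is continuous on
    a compact interval, and \<open>g\<close> is at most 2.\<close>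
  obtain M where M: "\<And>x. x \<in> {a..b} \<Longrightarrow> C x y / x \<le> M"
  proof -
    have "continuous_on {a..b} (\<lambda>x. C x y / x)"
      using continuous_on_subset[OF C_continuous[OF y] sub] ab by (intro continuous_intros) auto
    then have "bdd_above ((\<lambda>x. C x y / x) ` {a..b})"
      by (intro bounded_imp_bdd_above compact_imp_bounded compact_continuous_image) auto
    then obtain M where "\<forall>z\<in>(\<lambda>x. C x y / x) ` {a..b}. z \<le> M" by (auto simp: bdd_above_def)
    then show ?thesis by (intro that[of M]) auto
  qed
  have "(\<lambda>x. dC x y) \<in> borel_measurable (restrict_space borel {a..b})"
    using measurable_restrict_mono[OF dC_measurable[OF y] sub] .
  then have m: "(\<lambda>x. indicator {a..b} x *\<^sub>R dC x y) \<in> borel_measurable borel"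
    by (subst (asm) borel_measurable_restrict_space_iff) auto
  have "set_integrable lborel {a..b} (\<lambda>x. dC x y)"
    unfolding set_integrable_def
  proof (rule integrableI_bounded_set[where A = "{a..b}" and B = "M * 2"])
    show "AE x in lborel. x \<in> {a..b} \<longrightarrow> norm (indicator {a..b} x *\<^sub>R dC x y) \<le> M * 2"
    proof (intro AE_I2 impI)
      fix x assume x: "x \<in> {a..b}"
      then have x': "x \<in> {0<..<1}" using sub by auto
      have "0 \<le> C x y / x" using C_pos[OF x' y] x' by simp
      then have "dC x y \<le> M * 2" unfolding dC_def
        using M[OF x] pick_arg_in[OF x' y] by (intro mult_mono g_le g_nonneg) auto
      then show "norm (indicator {a..b} x *\<^sub>R dC x y) \<le> M * 2"
        using x dC_nonneg[OF x' y] by simp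
    qed
  qed (use m in \<open>simp_all add: emeasure_lborel_Icc_eq\<close>)
  then show "(\<lambda>x. dC x y) integrable_on {a..b}"
    by (rule set_borel_integral_eq_integral(1))
qed

end


section \<open>The Markov kernel\<close>

lemma measurable_kernel_emeasure:
  assumes K: "K \<in> unit_lebesgue \<rightarrow>\<^sub>M subprob_algebra unit_lebesgue" and B: "B \<in> sets unit_lebesgue"
  shows "(\<lambda>x. emeasure (K x) B) \<in> borel_measurable unit_lebesgue"
  using measurable_compose[OF K measurable_emeasure_subprob_algebra[OF B]] .

lemma nn_integral_unit_lebesgue:
  "(\<integral>\<^sup>+x. f x \<partial>unit_lebesgue) = (\<integral>\<^sup>+x\<in>{0..1}. f x \<partial>lborel)"
  unfolding unit_lebesgue_def by (rule nn_integral_restrict_space) simp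

lemma measurable_unit_lebesgue_indicator:
  fixes f :: "real \<Rightarrow> ennreal"
  assumes "f \<in> borel_measurable unit_lebesgue"
  shows "(\<lambda>x. f x * indicator {0..1} x) \<in> borel_measurable borel"
proof -
  have "f \<in> borel_measurable (restrict_space borel {0..1})"
    using assms by (simp add: measurable_cong_sets[OF sets_unit_lebesgue refl])
  then show ?thesis by (subst (asm) borel_measurable_restrict_space_iff_ennreal) auto
qed

locale evc_kernel = evc_pair +
  fixes K :: "real \<Rightarrow> real measure"
  assumes kern: "markov_kernel_of C K"
begin

lemma K_prob: "K \<in> unit_lebesgue \<rightarrow>\<^sub>M prob_algebra unit_lebesgue"
  using kern by (simp add: markov_kernel_of_def)

lemma K_subprob: "K \<in> unit_lebesgue \<rightarrow>\<^sub>M subprob_algebra unit_lebesgue"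
  using K_prob by (rule measurable_prob_algebraD)

lemma K_at:
  assumes "x \<in> {0..1}"
  shows "prob_space (K x)" "sets (K x) = sets unit_lebesgue"
  using measurable_space[OF K_prob, of x] assms by (auto simp: space_prob_algebra)

lemma nn_integral_K:
  assumes y: "y \<in> {0..1}" and ab: "0 \<le> a" "a \<le> b" "b \<le> 1"
  shows "(\<integral>\<^sup>+x\<in>{a<..b}. emeasure (K x) {0..y} \<partial>unit_lebesgue) = ennreal (C b y) - ennreal (C a y)"
proof -
  let ?\<mu> = "copula_measure C"
  have s: "{a<..b} \<in> sets unit_lebesgue" "{0..y} \<in> sets unit_lebesgue" "{0..a} \<in> sets unit_lebesgue"
    "{0..b} \<in> sets unit_lebesgue"
    using y ab by (auto simp: sets_unit_lebesgue_iff)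
  have "(\<integral>\<^sup>+x\<in>{a<..b}. emeasure (K x) {0..y} \<partial>unit_lebesgue) = emeasure ?\<mu> ({a<..b} \<times> {0..y})"
    using kern s by (simp add: markov_kernel_of_def)
  \<comment> \<open>The strip is a difference of two boxes with corner at the origin, where the
    copula measure is given by \<open>C\<close>.\<close>
  also have "{a<..b} \<times> {0..y} = {0..b} \<times> {0..y} - {0..a} \<times> {0..y}" using ab by auto
  also have "emeasure ?\<mu> \<dots> = emeasure ?\<mu> ({0..b} \<times> {0..y}) - emeasure ?\<mu> ({0..a} \<times> {0..y})"
    using s ab y by (intro emeasure_Diff)
      (auto simp: emeasure_copula_measure[OF cop] sets_copula_measure[OF cop])
  finally show ?thesis using ab y by (simp add: emeasure_copula_measure[OF cop])
qed

text \<open>Over every \<open>{a<..b}\<close> inside \<open>{p<..q}\<close> both sides integrate to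
  \<open>C b y - C a y\<close>: the kernel by disintegration, \<open>dC\<close> by the fundamental
  theorem. Staying away from 0 and 1 keeps to the region where \<open>C\<close> is given by
  \<open>A\<close>.\<close>

lemma K_eq_dC_within:
  assumes y: "y \<in> {0<..<1}" and pq: "0 < p" "p < q" "q < 1"
  shows "AE x in lborel. x \<in> {p<..q} \<longrightarrow> emeasure (K x) {0..y} = ennreal (dC x y)"
proof -
  have y': "{0..y} \<in> sets unit_lebesgue" using y by (auto simp: sets_unit_lebesgue_iff)
  have y01: "y \<in> {0..1}" using y by auto
  let ?f = "\<lambda>x. emeasure (K x) {0..y} * indicator {0..1} x"
  let ?g = "\<lambda>x. ennreal (dC x y) * indicator {0<..<1} x"
  have f: "?f \<in> borel_measurable borel"
    by (intro measurable_unit_lebesgue_indicator measurable_kernel_emeasure K_subprob y')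
  have "(\<lambda>x. ennreal (dC x y)) \<in> borel_measurable (restrict_space borel {0<..<1})"
    using dC_measurable[OF y] by simp
  then have g: "?g \<in> borel_measurable borel"
    by (subst (asm) borel_measurable_restrict_space_iff_ennreal) auto
  have F: "(\<integral>\<^sup>+x\<in>{a<..b}. ?f x \<partial>lborel) = ennreal (C b y - C a y)"
    if "p \<le> a" "a < b" "b \<le> q" for a b
  proof -
    have "(\<integral>\<^sup>+x\<in>{a<..b}. ?f x \<partial>lborel) = (\<integral>\<^sup>+x\<in>{a<..b}. emeasure (K x) {0..y} \<partial>unit_lebesgue)"
      unfolding nn_integral_unit_lebesgue by (intro nn_integral_cong) (simp add: mult_ac)
    also have "\<dots> = ennreal (C b y) - ennreal (C a y)"
      using that pq by (intro nn_integral_K y01) auto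
    also have "\<dots> = ennreal (C b y - C a y)"
      using C_pos[of a y] that pq y by (intro ennreal_minus) auto
    finally show ?thesis .
  qed
  have G: "(\<integral>\<^sup>+x\<in>{a<..b}. ?g x \<partial>lborel) = ennreal (C b y - C a y)"
    if "p \<le> a" "a < b" "b \<le> q" for a b
  proof -
    have "(\<integral>\<^sup>+x\<in>{a<..b}. ?g x \<partial>lborel) = (\<integral>\<^sup>+x. ennreal (dC x y) * indicator {a..b} x \<partial>lborel)"
    proof (rule nn_integral_cong_AE)
      show "AE x in lborel. ?g x * indicator {a<..b} x = ennreal (dC x y) * indicator {a..b} x"
        using AE_lborel_singleton[of a]
      proof eventually_elim
        case (elim x)
        then show ?case using that pq by (auto simp: indicator_def)
      qed
    qed
    also have "\<dots> = ennreal (C b y - C a y)"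
      using that pq y dC_nonneg by (intro nn_integral_has_integral_lebesgue' dC_has_integral) auto
    finally show ?thesis .
  qed
  have "AE x in lborel. x \<in> {p<..q} \<longrightarrow> ?f x = ?g x"
    using F G by (intro AE_eq_of_nn_integral_Ioc_eq f g pq(2)) (auto simp: F[OF order_refl pq(2) order_refl])
  then show ?thesis
    by eventually_elim (use pq in auto)
qed

text \<open>For one \<open>y\<close>, exhaust the open unit interval by countably many intervals
  \<open>{p<..q}\<close>. Countability of the rationals then yields one exceptional null set for all
  rational \<open>y\<close>.\<close>

lemma AE_K_eq_dC:
  "AE x in lborel. x \<in> {0<..<1} \<longrightarrow> (\<forall>y\<in>\<rat> \<inter> {0<..<1}. emeasure (K x) {0..y} = ennreal (dC x y))"
proof -
  have "AE x in lborel. x \<in> {0<..<1} \<longrightarrow> emeasure (K x) {0..y} = ennreal (dC x y)"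
    if y: "y \<in> {0<..<1}" for y
  proof -
    \<comment> \<open>The shift by 3 keeps \<open>p n\<close> at most 1/3, so that
      \<open>p n < 1 - p n\<close> for every \<open>n\<close>.\<close>
    define p where "p n = inverse (real (n + 3))" for n
    have p: "0 < p n" "p n < 1 - p n" "1 - p n < 1" for n
    proof -
      have "inverse (real (n + 3)) \<le> inverse 3" by (rule le_imp_inverse_le) auto
      then show "0 < p n" "p n < 1 - p n" "1 - p n < 1" by (auto simp: p_def)
    qed
    have lim: "p \<longlonglongrightarrow> 0"
      unfolding p_def using LIMSEQ_ignore_initial_segment[OF lim_inverse_n[where 'a=real], of 3] by simp
    have "AE x in lborel. \<forall>n. x \<in> {p n<..1 - p n} \<longrightarrow> emeasure (K x) {0..y} = ennreal (dC x y)"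
      unfolding AE_all_countable by (intro allI K_eq_dC_within y p)
    then show ?thesis
    proof eventually_elim
      case (elim x)
      show ?case
      proof
        assume x: "x \<in> {0<..<1}"
        have "eventually (\<lambda>n. p n < min x (1 - x)) sequentially"
          using x by (intro order_tendstoD(2)[OF lim]) auto
        then obtain n where "p n < min x (1 - x)"
          by (auto simp: eventually_sequentially)
        then show "emeasure (K x) {0..y} = ennreal (dC x y)" using elim[rule_format, of n] by simp
      qed
    qed
  qed
  then have "AE x in lborel. \<forall>y\<in>\<rat> \<inter> {0<..<1}. x \<in> {0<..<1} \<longrightarrow> emeasure (K x) {0..y} = ennreal (dC x y)"
    by (subst AE_ball_countable) (auto intro: countable_rat countable_subset[OF Int_lower1])
  then show ?thesis by eventually_elim blast
qed

text \<open>Rational \<open>y\<close> suffice, as \<open>measure_mono_of_Ioc\<close> compares measures on rational intervals only.\<close>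

definition kernel_formula_at :: "real \<Rightarrow> bool" where
  "kernel_formula_at x \<longleftrightarrow> x \<in> {0<..<1} \<and> (\<forall>y\<in>\<rat> \<inter> {0<..<1}. emeasure (K x) {0..y} = ennreal (dC x y))"

lemma AE_kernel_formula_at: "AE x in lborel. x \<in> {0<..<1} \<longrightarrow> kernel_formula_at x"
  using AE_K_eq_dC by eventually_elim (simp add: kernel_formula_at_def)

lemma ext_K:
  assumes "kernel_formula_at x"
  shows "finite_borel_measure (borel_extension (K x))"
proof -
  have "x \<in> {0..1}" using assms by (auto simp: kernel_formula_at_def)
  from K_at[OF this] show ?thesis
    by (intro finite_borel_measure_borel_extension prob_space.finite_measure)
qed

section \<open>From increments of the kernel to Borel sets charged by it\<close>

lemma measure_K_Ioc:
  assumes x: "kernel_formula_at x" and ab: "a \<in> \<rat>" "b \<in> \<rat>" "0 < a" "a < b" "b < 1"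
  shows "measure (borel_extension (K x)) {a<..b} = dC x b - dC x a"
proof -
  have x01: "x \<in> {0<..<1}" using x by (simp add: kernel_formula_at_def)
  then have "x \<in> {0..1}" by auto
  note K = K_at[OF this]
  interpret prob_space "K x" by fact
  have e: "measure (K x) {0..y} = dC x y" if "y \<in> \<rat>" "0 < y" "y < 1" for y
    using x that dC_nonneg[OF x01, of y] by (simp add: kernel_formula_at_def measure_def)
  have "measure (borel_extension (K x)) {a<..b} = measure (K x) ({0..b} - {0..a})"
    using ab by (subst measure_borel_extension[OF K(2)]) (auto intro!: arg_cong[where f="measure (K x)"])
  also have "\<dots> = measure (K x) {0..b} - measure (K x) {0..a}"
    using ab by (intro finite_measure_Diff) (auto simp: K(2) sets_unit_lebesgue_iff)
  finally show ?thesis using e ab by simp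
qed

text \<open>A discrete product rule. For \<open>a < b\<close> both summands are nonnegative, so
  dropping either one leaves a lower bound.\<close>

lemma dC_diff:
  "dC x b - dC x a = (C x a * (g (pick_arg x b) - g (pick_arg x a))
     + g (pick_arg x b) * (C x b - C x a)) / x"
  by (simp add: dC_def diff_divide_distrib add_divide_distrib algebra_simps)

text \<open>Keep the increment of \<open>g\<close> and apply \<open>g_diff_ge\<close>. By
  monotonicity \<open>C x c\<close> and \<open>1 - pick_arg x d\<close> are the least values of
  their factors on \<open>{c..d}\<close>, so the constant does not depend on \<open>a\<close> and
  \<open>b\<close>.\<close>

lemma dC_diff_ge_H:
  assumes x: "x \<in> {0<..<1}" and ab: "0 < c" "c \<le> a" "a < b" "b \<le> d" "d < 1"
  shows "C x c / x * (2 * (1 - pick_arg x d)) * (H (pick_arg x b) - H (pick_arg x a)) \<le> dC x b - dC x a"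
proof -
  have y: "a \<in> {0<..<1}" "b \<in> {0<..<1}" "c \<in> {0<..<1}" "d \<in> {0<..<1}" using ab by auto
  note T = y[THEN pick_arg_in[OF x]]
  have ab': "pick_arg x a \<le> pick_arg x b" using pick_arg_strict_mono[OF x, of a b] ab by simp
  have bd: "pick_arg x b \<le> pick_arg x d" using pick_arg_strict_mono[OF x, of b d] ab by (cases "b = d") auto
  have Hd: "0 \<le> H (pick_arg x b) - H (pick_arg x a)" using H_mono[OF ab'] by simp
  have "(2 * (1 - pick_arg x d)) * (H (pick_arg x b) - H (pick_arg x a))
      \<le> (2 * (1 - pick_arg x b)) * (H (pick_arg x b) - H (pick_arg x a))"
    using bd Hd by (intro mult_right_mono) auto
  also have "\<dots> \<le> g (pick_arg x b) - g (pick_arg x a)"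
    using T ab' by (intro g_diff_ge) auto
  finally have 1: "(2 * (1 - pick_arg x d)) * (H (pick_arg x b) - H (pick_arg x a)) \<le> \<dots>" .
  have "C x c * ((2 * (1 - pick_arg x d)) * (H (pick_arg x b) - H (pick_arg x a)))
     \<le> C x a * (g (pick_arg x b) - g (pick_arg x a))"
    using C_mono[OF x, of c a] ab C_pos[OF x y(1)] T Hd
    by (intro mult_mono 1) (auto intro!: mult_nonneg_nonneg)
  also have "\<dots> \<le> C x a * (g (pick_arg x b) - g (pick_arg x a)) + g (pick_arg x b) * (C x b - C x a)"
    using g_nonneg[of "pick_arg x b"] T C_mono[OF x, of a b] ab by simp
  finally have "C x c * ((2 * (1 - pick_arg x d)) * (H (pick_arg x b) - H (pick_arg x a))) / x \<le> \<dots> / x"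
    using x by (intro divide_right_mono) auto
  then show ?thesis unfolding dC_diff by (simp add: mult.assoc)
qed

text \<open>Keep the increment of \<open>C\<close> and apply \<open>C_diff_ge\<close>;
  \<open>g\<close> is least at \<open>c\<close> and \<open>m\<close> is least at
  \<open>d\<close>.\<close>

lemma dC_diff_ge_length:
  assumes x: "x \<in> {0<..<1}" and ab: "0 < c" "c \<le> a" "a < b" "b \<le> d" "d < 1"
  shows "g (pick_arg x c) * m (pick_arg x d) * (b - a) \<le> dC x b - dC x a"
proof -
  have y: "a \<in> {0<..<1}" "b \<in> {0<..<1}" "c \<in> {0<..<1}" "d \<in> {0<..<1}" using ab by auto
  note T = y[THEN pick_arg_in[OF x]]
  have ab': "pick_arg x a \<le> pick_arg x b" using pick_arg_strict_mono[OF x, of a b] ab by simp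
  have cb: "pick_arg x c \<le> pick_arg x b" using pick_arg_strict_mono[OF x, of c b] ab by simp
  have bd: "pick_arg x b \<le> pick_arg x d" using pick_arg_strict_mono[OF x, of b d] ab by (cases "b = d") auto
  have "x * m (pick_arg x d) * (b - a) \<le> x * m (pick_arg x b) * (b - a)"
    using m_antimono[of "pick_arg x b" "pick_arg x d"] T bd ab x
    by (intro mult_right_mono mult_left_mono) auto
  also have "\<dots> \<le> C x b - C x a" using ab by (intro C_diff_ge x) auto
  finally have 1: "x * m (pick_arg x d) * (b - a) \<le> C x b - C x a" .
  have "g (pick_arg x c) * (x * m (pick_arg x d) * (b - a)) \<le> g (pick_arg x b) * (C x b - C x a)"
    using T cb m_nonneg[of "pick_arg x d"] ab x g_nonneg[of "pick_arg x b"]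
    by (intro mult_mono 1 g_mono) auto
  also have "\<dots> \<le> C x a * (g (pick_arg x b) - g (pick_arg x a)) + g (pick_arg x b) * (C x b - C x a)"
    using g_mono[of "pick_arg x a" "pick_arg x b"] T ab' C_pos[OF x y(1)] by simp
  finally have "g (pick_arg x c) * (x * m (pick_arg x d) * (b - a)) / x \<le> \<dots> / x"
    using x by (intro divide_right_mono) auto
  then show ?thesis unfolding dC_diff using x by (simp add: mult.assoc)
qed

lemma rational_enclosure:
  fixes c d :: real
  assumes "0 < c" "d < 1"
  obtains p q where "p \<in> \<rat>" "q \<in> \<rat>" "0 < p" "p < c" "d < q" "q < 1"
  using Rats_dense_in_real[OF assms(1)] Rats_dense_in_real[OF assms(2)] by blast

text \<open>The common transfer step: increments of \<open>dC\<close> are kernel masses of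
  intervals, so a bound from below by \<open>k\<close> times \<open>N\<close> on intervals extends
  to Borel sets.\<close>

lemma emeasure_K_pos:
  assumes x: "kernel_formula_at x" and N: "finite_borel_measure N" and k: "0 < k"
    and cd: "c \<in> \<rat>" "d \<in> \<rat>" "0 < c" "d < 1"
    and le: "\<And>a b. c \<le> a \<Longrightarrow> a < b \<Longrightarrow> b \<le> d \<Longrightarrow> k * measure N {a<..b} \<le> dC x b - dC x a"
    and B: "B \<in> sets borel" "B \<subseteq> {c<..d}" and pos: "measure N B \<noteq> 0"
  shows "emeasure (K x) B \<noteq> 0"
proof -
  have "x \<in> {0..1}" using x by (auto simp: kernel_formula_at_def)
  note K = K_at[OF this]
  have "0 < k * measure N B" using k pos by (simp add: zero_less_measure_iff)
  also have "\<dots> \<le> measure (borel_extension (K x)) B"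
  proof (rule measure_mono_of_Ioc_within[OF ext_K[OF x] N _ cd(1,2) _ B])
    show "k * measure N {a<..b} \<le> measure (borel_extension (K x)) {a<..b}"
      if "a \<in> \<rat>" "b \<in> \<rat>" "c \<le> a" "a < b" "b \<le> d" for a b
      using le[of a b] that cd by (subst measure_K_Ioc[OF x]) auto
  qed (use k in simp)
  also have "\<dots> = measure (K x) (B \<inter> {0..1})"
    by (rule measure_borel_extension[OF K(2) B(1)])
  also have "B \<inter> {0..1} = B" using B cd by force
  finally show ?thesis by (auto simp: measure_def)
qed

text \<open>The comparison measure is the image of \<open>\<theta>\<close> under
  \<open>pick_inv x\<close>: its mass on \<open>{a<..b}\<close> is the increment of \<open>H\<close>
  along \<open>pick_arg x\<close>, which \<open>dC_diff_ge_H\<close> bounds.\<close>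

lemma emeasure_K_pos_of_theta:
  assumes x: "kernel_formula_at x" and cd: "0 < c" "d < 1"
    and B: "B \<in> sets borel" "B \<subseteq> {c..d}"
    and pos: "emeasure \<theta> {t\<in>{0<..<1}. pick_inv x t \<in> B} \<noteq> 0"
  shows "emeasure (K x) B \<noteq> 0"
proof -
  have x01: "x \<in> {0<..<1}" using x by (simp add: kernel_formula_at_def)
  \<comment> \<open>The kernel formula is known at rational arguments, so \<open>{c..d}\<close> is
    enlarged to a rational interval inside the open unit interval.\<close>
  obtain p q where pq: "p \<in> \<rat>" "q \<in> \<rat>" "0 < p" "p < c" "d < q" "q < 1"
    using rational_enclosure[OF cd] .
  \<comment> \<open>The default \<open>- 1\<close> lies outside every set of positive numbers, so
    mass of \<open>\<theta>\<close> at 0 or 1 is never counted.\<close>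
  define h where "h t = (if t \<in> {0<..<1} then pick_inv x t else - 1)" for t
  have h [measurable]: "h \<in> borel_measurable borel"
    unfolding h_def pick_inv_def by measurable
  define N where "N = distr (borel_extension \<theta>) borel h"
  have hN: "h \<in> borel_extension \<theta> \<rightarrow>\<^sub>M borel" by measurable
  have N: "finite_borel_measure N"
  proof -
    interpret N: finite_measure N
      unfolding N_def by (rule ext.finite_measure_distr[OF hN])
    show ?thesis by standard (simp add: N_def)
  qed
  have mN: "measure N X = measure \<theta> {t\<in>{0<..<1}. pick_inv x t \<in> X}"
    if X: "X \<in> sets borel" "X \<subseteq> {0<..}" for X
  proof -
    have "h -` X = {t\<in>{0<..<1}. pick_inv x t \<in> X}" using X by (auto simp: h_def split: if_splits)
    moreover have "h -` X \<in> sets borel" using measurable_sets[OF h X(1)] by simp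
    ultimately show ?thesis unfolding N_def
      by (subst measure_distr[OF hN X(1)])
        (auto simp: ext.borel_UNIV measure_borel_extension[OF sets_theta] intro!: arg_cong[where f="measure \<theta>"])
  qed
  have NIoc: "measure N {a<..b} = H (pick_arg x b) - H (pick_arg x a)"
    if "p \<le> a" "a < b" "b \<le> q" for a b
  proof -
    have ab: "a \<in> {0<..<1}" "b \<in> {0<..<1}" using that pq by auto
    note T = ab[THEN pick_arg_in[OF x01]]
    have iff: "t \<in> {pick_arg x a<..pick_arg x b} \<longleftrightarrow> pick_inv x t \<in> {a<..b}" if t: "t \<in> {0<..<1}" for t
    proof -
      have less: "pick_arg x u < pick_arg x v \<longleftrightarrow> u < v"
        if "u \<in> {0<..<1}" "v \<in> {0<..<1}" for u v
        using pick_arg_strict_mono[OF x01, of u v] pick_arg_strict_mono[OF x01, of v u] that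
        by (cases u v rule: linorder_cases) auto
      have "pick_arg x a < t \<longleftrightarrow> a < pick_inv x t" "pick_arg x b < t \<longleftrightarrow> b < pick_inv x t"
        using less[OF ab(1) pick_inv_in[OF x01 t]] less[OF ab(2) pick_inv_in[OF x01 t]]
        by (simp_all only: pick_arg_pick_inv[OF x01 t])
      then show ?thesis by (simp only: greaterThanAtMost_iff) linarith
    qed
    have eq: "{t\<in>{0<..<1}. pick_inv x t \<in> {a<..b}} = {pick_arg x a<..pick_arg x b} \<inter> {0..1}"
    proof (intro set_eqI)
      fix t
      show "t \<in> {t\<in>{0<..<1}. pick_inv x t \<in> {a<..b}} \<longleftrightarrow> t \<in> {pick_arg x a<..pick_arg x b} \<inter> {0..1}"
        using iff[of t] T by (cases "t \<in> {0<..<1}") auto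
    qed
    have "measure N {a<..b} = measure \<theta> {t\<in>{0<..<1}. pick_inv x t \<in> {a<..b}}"
      using ab by (intro mN) auto
    also have "\<dots> = measure (borel_extension \<theta>) {pick_arg x a<..pick_arg x b}"
      unfolding eq by (rule measure_borel_extension[OF sets_theta, symmetric]) simp
    also have "\<dots> = H (pick_arg x b) - H (pick_arg x a)"
      unfolding H_def using pick_arg_strict_mono[OF x01, of a b] that ab
      by (intro ext.cdf_diff_eq[symmetric]) auto
    finally show ?thesis .
  qed
  have y: "p \<in> {0<..<1}" "q \<in> {0<..<1}" if "B \<noteq> {}"
    using pq that B by force+
  have "B \<noteq> {}" using pos by auto
  note y = y[OF this]
  show ?thesis
  proof (rule emeasure_K_pos[OF x N _ pq(1,2,3) pq(6)])
    show "0 < C x p / x * (2 * (1 - pick_arg x q))"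
      using C_pos[OF x01 y(1)] x01 pick_arg_in[OF x01 y(2)] by simp
    show "C x p / x * (2 * (1 - pick_arg x q)) * measure N {a<..b} \<le> dC x b - dC x a"
      if "p \<le> a" "a < b" "b \<le> q" for a b
      unfolding NIoc[OF that] using that pq by (intro dC_diff_ge_H x01) auto
    show "B \<subseteq> {p<..q}" using B pq by force
    show "measure N B \<noteq> 0"
    proof -
      have "B \<subseteq> {0<..}" using B cd by force
      from mN[OF B(1) this] show ?thesis
        using pos by (simp add: theta.emeasure_eq_measure)
    qed
  qed (fact B)
qed

lemma emeasure_K_pos_of_lborel:
  assumes x: "kernel_formula_at x" and cd: "0 < c" "d < 1"
    and g: "\<And>t. t \<in> {0<..<1} \<Longrightarrow> 1 - t < A t" and m: "\<And>t. t \<in> {0<..<1} \<Longrightarrow> t < A t"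
    and B: "B \<in> sets borel" "B \<subseteq> {c..d}"
    and pos: "emeasure lborel B \<noteq> 0"
  shows "emeasure (K x) B \<noteq> 0"
proof -
  have x01: "x \<in> {0<..<1}" using x by (simp add: kernel_formula_at_def)
  obtain p q where pq: "p \<in> \<rat>" "q \<in> \<rat>" "0 < p" "p < c" "d < q" "q < 1"
    using rational_enclosure[OF cd] .
  have "B \<noteq> {}" using pos by auto
  then have y: "p \<in> {0<..<1}" "q \<in> {0<..<1}" using pq B by force+
  note T = y[THEN pick_arg_in[OF x01]]
  have Bpq: "B \<subseteq> {p<..q}" using B pq by force
  with \<open>B \<noteq> {}\<close> have "p < q" by force
  \<comment> \<open>Cutting Lebesgue measure down to \<open>{p<..q}\<close> makes it finite without
    changing the mass of \<open>B\<close>.\<close>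
  define N where "N = density lborel (indicator {p<..q})"
  have eN: "emeasure N X = emeasure lborel ({p<..q} \<inter> X)" if "X \<in> sets borel" for X
    unfolding N_def using that by (intro emeasure_restricted) auto
  have N: "finite_borel_measure N"
  proof -
    interpret N: finite_measure N
      using eN[of UNIV] \<open>p < q\<close> by (intro finite_measureI) (simp add: N_def)
    show ?thesis by standard (simp add: N_def)
  qed
  show ?thesis
  proof (rule emeasure_K_pos[OF x N _ pq(1,2,3) pq(6) _ B(1) Bpq])
    \<comment> \<open>By \<open>g_ge\<close> the first factor is at least the gap between
      \<open>A\<close> and \<open>1 - t\<close>; the numerator of the second is the gap between
      \<open>A\<close> and \<open>t\<close>. Both gaps are strict here.\<close>
    show "0 < g (pick_arg x p) * m (pick_arg x q)"
      using g_ge[of "pick_arg x p"] g[OF T(1)] m[OF T(2)] T by (simp add: m_def)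
    show "g (pick_arg x p) * m (pick_arg x q) * measure N {a<..b} \<le> dC x b - dC x a"
      if "p \<le> a" "a < b" "b \<le> q" for a b
    proof -
      have "{p<..q} \<inter> {a<..b} = {a<..b}" using that by auto
      then have "measure N {a<..b} = b - a" using eN[of "{a<..b}"] that by (simp add: measure_def)
      then show ?thesis using that pq by (simp only:) (intro dC_diff_ge_length x01, auto)
    qed
    have "{p<..q} \<inter> B = B" using Bpq by auto
    moreover have "emeasure lborel B \<le> emeasure lborel {p<..q}"
      using Bpq by (intro emeasure_mono) auto
    then have "emeasure lborel B \<noteq> \<infinity>" using \<open>p < q\<close> by (auto simp: top_unique)
    ultimately show "measure N B \<noteq> 0"
      using pos eN[OF B(1)] by (simp add: measure_def enn2real_eq_0_iff)
  qed
qed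

end


section \<open>Full support\<close>

lemma emeasure_pos_of_full_support:
  assumes "measure_support M = space M" and "open U" and "U \<inter> space M \<noteq> {}"
  shows "emeasure M (U \<inter> space M) \<noteq> 0"
  using assms unfolding measure_support_def by blast

lemma measure_support_eq_space:
  assumes "\<And>U. open U \<Longrightarrow> U \<inter> space M \<noteq> {} \<Longrightarrow> emeasure M (U \<inter> space M) \<noteq> 0"
  shows "measure_support M = space M"
  using assms unfolding measure_support_def by blast

text \<open>The interval need not contain \<open>x\<close>; this covers the endpoints 0 and 1, near
  which it lies to one side.\<close>

lemma open_Icc_obtains_Ioo:
  fixes U :: "real set"
  assumes "open U" "x \<in> U" "x \<in> {0..1}"
  obtains a b where "0 < a" "a < b" "b < 1" "{a<..<b} \<subseteq> U"
proof -
  obtain e where e: "e > 0" "ball x e \<subseteq> U" using assms by (meson openE)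
  have "max 0 (x - e) < min 1 (x + e)" using e assms by auto
  then obtain a where a: "max 0 (x - e) < a" "a < min 1 (x + e)" using dense by blast
  then obtain b where b: "a < b" "b < min 1 (x + e)" using dense by blast
  show ?thesis
  proof (rule that)
    show "0 < a" "a < b" "b < 1" using a b by auto
    show "{a<..<b} \<subseteq> U" using a b e by (force simp: dist_real_def)
  qed
qed

text \<open>An open set meeting the square contains an open rectangle inside the open square. Were
  the rectangle null, the kernel mass of its second side would vanish for almost every
  \<open>x\<close> in its first side, which has positive length.\<close>

lemma kernel_measure_full_support:
  assumes K: "sub_markov_kernel K"
    and pos: "AE x in lborel. x \<in> {0<..<1} \<longrightarrow> (\<forall>c d. 0 < c \<longrightarrow> c < d \<longrightarrow> d < 1 \<longrightarrow> emeasure (K x) {c<..<d} \<noteq> 0)"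
  shows "measure_support (kernel_measure K) = {0..1} \<times> {0..1}"
proof -
  have sp: "space (kernel_measure K) = {0..1} \<times> {0..1}"
    using sets_eq_imp_space_eq[OF sets_kernel_measure[OF K]] by (simp add: space_pair_measure)
  have "measure_support (kernel_measure K) = space (kernel_measure K)"
  proof (rule measure_support_eq_space, unfold sp)
    fix U :: "(real \<times> real) set"
    assume U: "open U" "U \<inter> {0..1} \<times> {0..1} \<noteq> {}"
    then obtain z where z: "z \<in> U \<inter> {0..1} \<times> {0..1}" by (meson all_not_in_conv)
    define x y where "x = fst z" and "y = snd z"
    have xy: "(x, y) \<in> U" "x \<in> {0..1}" "y \<in> {0..1}" using z by (simp_all add: x_def y_def mem_Times_iff)
    obtain V W where "open V" "open W" "(x, y) \<in> V \<times> W" "V \<times> W \<subseteq> U"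
      by (rule open_prod_elim[OF U(1) xy(1)])
    then have VW: "open V" "open W" "x \<in> V" "y \<in> W" "V \<times> W \<subseteq> U" by simp_all
    obtain a b where ab: "0 < a" "a < b" "b < 1" "{a<..<b} \<subseteq> V"
      using open_Icc_obtains_Ioo[OF VW(1,3) xy(2)] .
    obtain c d where cd: "0 < c" "c < d" "d < 1" "{c<..<d} \<subseteq> W"
      using open_Icc_obtains_Ioo[OF VW(2,4) xy(3)] .
    have s: "{a<..<b} \<in> sets unit_lebesgue" "{c<..<d} \<in> sets unit_lebesgue"
      using ab cd by (auto simp: sets_unit_lebesgue_iff)
    have [measurable]: "(\<lambda>x. emeasure (K x) {c<..<d} * indicator {0..1} x) \<in> borel_measurable borel"
      using K by (intro measurable_unit_lebesgue_indicator measurable_kernel_emeasure s)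
        (simp add: sub_markov_kernel_def)
    have "emeasure (kernel_measure K) ({a<..<b} \<times> {c<..<d})
        = (\<integral>\<^sup>+x\<in>{a<..<b}. emeasure (K x) {c<..<d} \<partial>unit_lebesgue)"
      by (rule emeasure_kernel_measure_times[OF K s])
    also have "\<dots> = (\<integral>\<^sup>+x. emeasure (K x) {c<..<d} * indicator {0..1} x * indicator {a<..<b} x \<partial>lborel)"
      unfolding nn_integral_unit_lebesgue by (intro nn_integral_cong) (simp add: mult_ac)
    also have "\<dots> \<noteq> 0"
    proof
      assume "(\<integral>\<^sup>+x. emeasure (K x) {c<..<d} * indicator {0..1} x * indicator {a<..<b} x \<partial>lborel) = 0"
      then have "AE x in lborel. emeasure (K x) {c<..<d} * indicator {0..1} x * indicator {a<..<b} x = 0"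
        by (subst (asm) nn_integral_0_iff_AE) auto
      with pos have "AE x in lborel. x \<notin> {a<..<b}"
      proof eventually_elim
        case (elim x)
        show ?case
        proof
          assume x: "x \<in> {a<..<b}"
          then have "emeasure (K x) {c<..<d} \<noteq> 0" using elim(1) ab cd by auto
          with elim(2) x ab show False by auto
        qed
      qed
      then have "{a<..<b} \<in> null_sets lborel"
        using AE_iff_null_sets[of "{a<..<b}" lborel] by simp
      with ab show False by (simp add: null_sets_def)
    qed
    finally have "emeasure (kernel_measure K) ({a<..<b} \<times> {c<..<d}) \<noteq> 0" .
    moreover have "emeasure (kernel_measure K) ({a<..<b} \<times> {c<..<d})
        \<le> emeasure (kernel_measure K) (U \<inter> {0..1} \<times> {0..1})"
    proof (rule emeasure_mono)
      have "{a<..<b} \<times> {c<..<d} \<subseteq> U" using VW(5) ab(4) cd(4) by blast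
      moreover have "{a<..<b} \<times> {c<..<d} \<subseteq> {0..1} \<times> {0..1}"
        using ab cd by (intro Sigma_mono) auto
      ultimately show "{a<..<b} \<times> {c<..<d} \<subseteq> U \<inter> {0..1} \<times> {0..1}" by blast
      show "U \<inter> {0..1} \<times> {0..1} \<in> sets (kernel_measure K)"
        unfolding sets_kernel_measure[OF K] sets_unit_square using U(1)
        by (subst sets_restrict_space_iff) (simp_all add: borel_closed borel_open closed_Times)
    qed
    ultimately show "emeasure (kernel_measure K) (U \<inter> {0..1} \<times> {0..1}) \<noteq> 0"
      by (auto simp: zero_less_iff_neq_zero[symmetric])
  qed
  then show ?thesis by (simp add: sp)
qed

section \<open>Sets not charged by given parts of a decomposition\<close>

lemma lebesgue_decompositionD:
  assumes "lebesgue_decomposition M Mabs Mdis Msing"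
  shows "sets Mabs = sets unit_lebesgue" "sets Mdis = sets unit_lebesgue" "sets Msing = sets unit_lebesgue"
    "E \<in> sets unit_lebesgue \<Longrightarrow> emeasure M E = emeasure Mabs E + emeasure Mdis E + emeasure Msing E"
    "absolutely_continuous unit_lebesgue Mabs" "discrete_on_unit Mdis" "singular_on_unit Msing"
  using assms by (auto simp: lebesgue_decomposition_def)

lemma null_sets_unit_lebesgue_iff:
  "B \<in> null_sets unit_lebesgue \<longleftrightarrow> B \<in> null_sets lborel \<and> B \<subseteq> {0..1}"
  unfolding unit_lebesgue_def by (subst null_sets_restrict_space) auto

lemma absolutely_continuous_emeasure_zero:
  assumes "absolutely_continuous unit_lebesgue M" "B \<in> null_sets lborel" "B \<subseteq> {0..1}"
  shows "emeasure M B = 0"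
  using assms null_sets_unit_lebesgue_iff by (auto simp: absolutely_continuous_def)

lemma emeasure_zero_of_subset:
  assumes "emeasure M N = 0" "B \<subseteq> N" "N \<in> sets M"
  shows "emeasure M B = 0"
  using emeasure_mono[OF assms(2,3)] assms(1) by simp

lemma discrete_on_unitE:
  assumes "discrete_on_unit M"
  obtains D where "D \<subseteq> {0..1}" "countable D" "emeasure M ({0..1} - D) = 0" "D \<in> sets borel"
proof -
  obtain D where D: "D \<subseteq> {0..1}" "countable D" "emeasure M ({0..1} - D) = 0"
    using assms unfolding discrete_on_unit_def by blast
  moreover have "D \<in> sets borel" by (rule sets.countable[OF _ D(2)]) simp
  ultimately show ?thesis by (rule that)
qed

lemma compact_zero_set:
  fixes f :: "real \<Rightarrow> real"
  assumes "continuous_on {0..1} f"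
  shows "compact {t \<in> {0..1}. f t = 0}"
proof -
  have "closed ({0..1} \<inter> f -` {0})"
    using assms by (rule continuous_closed_preimage) auto
  moreover have "{0..1} \<inter> f -` {0} = {t \<in> {0..1}. f t = 0}" by auto
  ultimately show ?thesis
    unfolding compact_eq_bounded_closed by (auto intro: bounded_subset[of "{0..1}"])
qed

section \<open>Each part of the kernel charges every open interval\<close>

context evc_kernel
begin

text \<open>Full support puts an atom \<open>t\<close> of \<open>\<theta>dis\<close> between
  \<open>pick_arg x c\<close> and \<open>pick_arg x d\<close>. The kernel then has an atom at
  \<open>pick_inv x t\<close>, and only its discrete part can have one.\<close>

lemma Kdis_pos:
  assumes x: "kernel_formula_at x" and dec: "lebesgue_decomposition \<theta> \<theta>abs \<theta>dis \<theta>sing"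
    and full: "measure_support \<theta>dis = {0..1}"
    and decK: "lebesgue_decomposition (K x) Kabs Kdis Ksing"
    and cd: "0 < c" "c < d" "d < 1"
  shows "emeasure Kdis {c<..<d} \<noteq> 0"
proof -
  note T = lebesgue_decompositionD[OF dec] and L = lebesgue_decompositionD[OF decK]
  have x01: "x \<in> {0<..<1}" using x by (simp add: kernel_formula_at_def)
  have sp: "space \<theta>dis = {0..1}" using sets_eq_imp_space_eq[OF T(2)] by simp
  let ?S = "{pick_arg x c<..<pick_arg x d}"
  have S: "?S \<subseteq> {0..1}" "?S \<noteq> {}"
    using pick_arg_in[OF x01, of c] pick_arg_in[OF x01, of d] pick_arg_strict_mono[OF x01, of c d] cd by auto
  have S0: "emeasure \<theta>dis ?S \<noteq> 0"
    using emeasure_pos_of_full_support[of \<theta>dis ?S] full sp S by (simp add: inf_absorb1)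
  obtain D where D: "D \<subseteq> {0..1}" "countable D" "emeasure \<theta>dis ({0..1} - D) = 0" "D \<in> sets borel"
    using discrete_on_unitE[OF T(6)] .
  \<comment> \<open>Otherwise countably many null singletons and the complement of \<open>D\<close>
    would cover \<open>?S\<close>.\<close>
  have "\<exists>t\<in>D \<inter> ?S. emeasure \<theta>dis {t} \<noteq> 0"
  proof (rule ccontr)
    assume "\<not> ?thesis"
    then have "emeasure \<theta>dis {t} = 0" if "t \<in> D \<inter> ?S" for t using that by blast
    then have "{t} \<in> null_sets \<theta>dis" if "t \<in> D \<inter> ?S" for t
      using that S by (auto simp: null_sets_def T(2) sets_unit_lebesgue_iff)
    then have "(\<Union>t\<in>D \<inter> ?S. {t}) \<in> null_sets \<theta>dis"
      using D by (intro null_sets_UN') auto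
    moreover have "{0..1} - D \<in> null_sets \<theta>dis"
      using D by (auto simp: null_sets_def T(2) sets_unit_lebesgue_iff)
    ultimately have n: "(\<Union>t\<in>D \<inter> ?S. {t}) \<union> ({0..1} - D) \<in> null_sets \<theta>dis" by (rule null_sets.Un)
    have "emeasure \<theta>dis ?S = 0"
      by (rule emeasure_zero_of_subset[OF null_setsD1[OF n] _ null_setsD2[OF n]]) (use S in auto)
    with S0 show False ..
  qed
  then obtain t where t: "t \<in> ?S" "emeasure \<theta>dis {t} \<noteq> 0" by blast
  have t01: "t \<in> {0<..<1}"
    using t(1) pick_arg_in[OF x01, of c] pick_arg_in[OF x01, of d] cd by auto
  let ?y = "pick_inv x t"
  have y: "?y \<in> {c<..<d}"
    using t(1) pick_arg_strict_mono[OF x01, of ?y c] pick_arg_strict_mono[OF x01, of d ?y]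
      pick_inv_in[OF x01 t01] pick_arg_pick_inv[OF x01 t01] cd
    by (cases ?y c rule: linorder_cases; cases ?y d rule: linorder_cases) auto
  have "emeasure \<theta> {t} \<noteq> 0"
    using t T(4)[of "{t}"] t01 by (auto simp: sets_unit_lebesgue_iff)
  moreover have "emeasure \<theta> {t} \<le> emeasure \<theta> {s\<in>{0<..<1}. pick_inv x s \<in> {?y}}"
  proof (rule emeasure_mono)
    have "{s\<in>{0<..<1}. pick_inv x s \<in> {?y}} = {t}"
      using t01 pick_arg_pick_inv[OF x01] by (auto, metis greaterThanLessThan_iff)
    then show "{s\<in>{0<..<1}. pick_inv x s \<in> {?y}} \<in> sets \<theta>"
      using t01 by (simp add: sets_theta sets_unit_lebesgue_iff)
  qed (use t01 in auto)
  ultimately have "emeasure \<theta> {s\<in>{0<..<1}. pick_inv x s \<in> {?y}} \<noteq> 0" by auto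
  then have "emeasure (K x) {?y} \<noteq> 0"
    using cd y by (intro emeasure_K_pos_of_theta[OF x cd(1,3)]) auto
  moreover have "emeasure Kabs {?y} = 0"
    using y cd by (intro absolutely_continuous_emeasure_zero[OF L(5)]) auto
  moreover have "emeasure Ksing {?y} = 0"
    using L(7) y cd by (auto simp: singular_on_unit_def)
  ultimately have "emeasure Kdis {?y} \<noteq> 0"
    using L(4)[of "{?y}"] y cd by (auto simp: sets_unit_lebesgue_iff)
  moreover have "emeasure Kdis {?y} \<le> emeasure Kdis {c<..<d}"
    using y cd by (intro emeasure_mono) (auto simp: L(2) sets_unit_lebesgue_iff)
  ultimately show ?thesis by auto
qed

text \<open>Transport a null set carrying \<open>\<theta>sing\<close> to the \<open>y\<close> axis
  and remove a countable set carrying \<open>Kdis\<close>. The result is still charged by the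
  kernel, but neither by \<open>Kabs\<close> nor by \<open>Kdis\<close>.\<close>

lemma Ksing_pos:
  assumes x: "kernel_formula_at x" and dec: "lebesgue_decomposition \<theta> \<theta>abs \<theta>dis \<theta>sing"
    and full: "measure_support \<theta>sing = {0..1}"
    and decK: "lebesgue_decomposition (K x) Kabs Kdis Ksing"
    and cd: "0 < c" "c < d" "d < 1"
  shows "emeasure Ksing {c<..<d} \<noteq> 0"
proof -
  note T = lebesgue_decompositionD[OF dec] and L = lebesgue_decompositionD[OF decK]
  have x01: "x \<in> {0<..<1}" using x by (simp add: kernel_formula_at_def)
  have sp: "space \<theta>sing = {0..1}" using sets_eq_imp_space_eq[OF T(3)] by simp
  let ?S = "{pick_arg x c<..<pick_arg x d}"
  have Sin: "pick_arg x c \<in> {0<..<1}" "pick_arg x d \<in> {0<..<1}"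
    using pick_arg_in[OF x01] cd by auto
  then have S: "?S \<subseteq> {0..1}" "?S \<subseteq> {0<..<1}" "?S \<noteq> {}"
    using pick_arg_strict_mono[OF x01, of c d] cd by auto
  have S0: "emeasure \<theta>sing ?S \<noteq> 0"
    using emeasure_pos_of_full_support[of \<theta>sing ?S] full sp S by (simp add: inf_absorb1)
  obtain N where N: "N \<in> null_sets lborel" "N \<subseteq> {0..1}" "emeasure \<theta>sing ({0..1} - N) = 0"
    using T(7) by (auto simp: singular_on_unit_def null_sets_unit_lebesgue_iff)
  have Nb [measurable]: "N \<in> sets borel" using N(1) by (auto dest: null_setsD2)
  obtain D where D: "D \<subseteq> {0..1}" "countable D" "emeasure Kdis ({0..1} - D) = 0" "D \<in> sets borel"
    using discrete_on_unitE[OF L(6)] .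
  define B where "B = {y \<in> {c<..<d}. pick_arg x y \<in> N} - D"
  have "{y \<in> {c<..<d}. pick_arg x y \<in> N} = {c<..<d} \<inter> (pick_arg x -` N \<inter> space borel)" by auto
  also have "\<dots> \<in> sets borel" by measurable
  finally have Bb: "B \<in> sets borel" unfolding B_def using D(4) by simp
  have B01: "B \<subseteq> {0..1}" "B \<subseteq> {0<..<1}" using cd by (auto simp: B_def)
  have Bu: "B \<in> sets unit_lebesgue" using Bb B01 by (simp add: sets_unit_lebesgue_iff)
  \<comment> \<open>\<open>B\<close> lies in the image of a null set under the differentiable map
    \<open>pick_inv x\<close>.\<close>
  have Bnull: "B \<in> null_sets lborel"
  proof -
    have "N \<inter> {0<..<1} \<in> null_sets lborel"
      using N(1) by (rule null_set_Int2) simp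
    then have "negligible (N \<inter> {0<..<1})"
      by (simp add: negligible_iff_null_sets null_sets_completionI)
    then have "negligible (pick_inv x ` (N \<inter> {0<..<1}))"
      by (rule negligible_differentiable_image_negligible[rotated])
        (auto intro: differentiable_on_subset[OF pick_inv_differentiable])
    moreover have "B \<subseteq> pick_inv x ` (N \<inter> {0<..<1})"
    proof
      fix y assume y: "y \<in> B"
      with B01 have "y \<in> {0<..<1}" by auto
      from pick_arg_in[OF x01 this] pick_inv_pick_arg[OF x01 this] y
      show "y \<in> pick_inv x ` (N \<inter> {0<..<1})"
        by (intro image_eqI[of _ _ "pick_arg x y"]) (auto simp: B_def)
    qed
    ultimately have "negligible B" by (rule negligible_subset)
    then have "emeasure lebesgue B = 0" by (simp add: negligible_iff_emeasure0 Bb)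
    then show ?thesis using Bb by (simp add: null_sets_def)
  qed
  let ?B' = "{t\<in>{0<..<1}. pick_inv x t \<in> B}"
  have B'b: "?B' \<in> sets borel"
  proof -
    have [measurable]: "pick_inv x \<in> borel_measurable borel" unfolding pick_inv_def by measurable
    have "?B' = {0<..<1} \<inter> (pick_inv x -` B \<inter> space borel)" by auto
    also have "\<dots> \<in> sets borel" using Bb by measurable
    finally show ?thesis .
  qed
  \<comment> \<open>Removing \<open>D\<close> costs only the countable set \<open>pick_arg x\<close>
    applied to its points in the open interval, which \<open>\<theta>sing\<close> ignores as it has
    no atoms.\<close>
  have sub: "?S \<subseteq> (?B' \<union> ({0..1} - N)) \<union> (\<Union>t\<in>pick_arg x ` (D \<inter> {0<..<1}). {t})"
  proof
    fix t assume t: "t \<in> ?S"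
    with S have t01: "t \<in> {0<..<1}" by auto
    let ?y = "pick_inv x t"
    have y01: "?y \<in> {0<..<1}" by (rule pick_inv_in[OF x01 t01])
    have Ty: "pick_arg x ?y = t" by (rule pick_arg_pick_inv[OF x01 t01])
    have "?y \<in> {c<..<d}"
      using t pick_arg_strict_mono[OF x01, of ?y c] pick_arg_strict_mono[OF x01, of d ?y] y01 Ty cd
      by (cases ?y c rule: linorder_cases; cases ?y d rule: linorder_cases) auto
    then show "t \<in> (?B' \<union> ({0..1} - N)) \<union> (\<Union>t\<in>pick_arg x ` (D \<inter> {0<..<1}). {t})"
      using Ty y01 t01 by (cases "?y \<in> D") (auto simp: B_def intro!: image_eqI[of _ _ ?y])
  qed
  have "emeasure \<theta>sing ?B' \<noteq> 0"
  proof
    assume "emeasure \<theta>sing ?B' = 0"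
    then have "?B' \<in> null_sets \<theta>sing"
      using B'b by (auto simp: null_sets_def T(3) sets_unit_lebesgue_iff)
    moreover have "{0..1} - N \<in> null_sets \<theta>sing"
      using N(3) Nb by (auto simp: null_sets_def T(3) sets_unit_lebesgue_iff)
    moreover have "(\<Union>t\<in>pick_arg x ` (D \<inter> {0<..<1}). {t}) \<in> null_sets \<theta>sing"
    proof (rule null_sets_UN')
      fix t assume "t \<in> pick_arg x ` (D \<inter> {0<..<1})"
      then have "t \<in> {0<..<1}" using pick_arg_in[OF x01] by auto
      then have "t \<in> {0..1}" by auto
      then show "{t} \<in> null_sets \<theta>sing"
        using T(7) by (auto simp: singular_on_unit_def null_sets_def T(3) sets_unit_lebesgue_iff)
    qed (use D in auto)
    ultimately have n: "(?B' \<union> ({0..1} - N)) \<union> (\<Union>t\<in>pick_arg x ` (D \<inter> {0<..<1}). {t}) \<in> null_sets \<theta>sing"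
      by (intro null_sets.Un)
    have "emeasure \<theta>sing ?S = 0"
      by (rule emeasure_zero_of_subset[OF null_setsD1[OF n] sub null_setsD2[OF n]])
    with S0 show False ..
  qed
  then have "emeasure \<theta> ?B' \<noteq> 0"
    using T(4)[of ?B'] B'b by (force simp: sets_unit_lebesgue_iff)
  then have "emeasure (K x) B \<noteq> 0"
    using Bb by (intro emeasure_K_pos_of_theta[OF x cd(1,3)]) (auto simp: B_def)
  moreover have "emeasure Kabs B = 0"
    by (rule absolutely_continuous_emeasure_zero[OF L(5) Bnull B01(1)])
  moreover have "emeasure Kdis B = 0"
    using D B01 by (intro emeasure_zero_of_subset[OF D(3)]) (auto simp: B_def L(2) sets_unit_lebesgue_iff)
  ultimately have "emeasure Ksing B \<noteq> 0"
    using L(4)[OF Bu] by auto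
  moreover have "emeasure Ksing B \<le> emeasure Ksing {c<..<d}"
    using cd by (intro emeasure_mono) (auto simp: L(3) sets_unit_lebesgue_iff B_def)
  ultimately show ?thesis by auto
qed

text \<open>Removing from \<open>{c<..<d}\<close> the null sets that carry \<open>Ksing\<close> and
  \<open>Kdis\<close> keeps its length, so the kernel still charges what is left, and only
  \<open>Kabs\<close> can account for this.\<close>

lemma Kabs_pos:
  assumes x: "kernel_formula_at x"
    and g: "\<And>t. t \<in> {0<..<1} \<Longrightarrow> 1 - t < A t" and m: "\<And>t. t \<in> {0<..<1} \<Longrightarrow> t < A t"
    and decK: "lebesgue_decomposition (K x) Kabs Kdis Ksing"
    and cd: "0 < c" "c < d" "d < 1"
  shows "emeasure Kabs {c<..<d} \<noteq> 0"
proof -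
  note L = lebesgue_decompositionD[OF decK]
  obtain N where N: "N \<in> null_sets lborel" "N \<subseteq> {0..1}" "emeasure Ksing ({0..1} - N) = 0"
    using L(7) by (auto simp: singular_on_unit_def null_sets_unit_lebesgue_iff)
  have Nb [measurable]: "N \<in> sets borel" using N(1) by (auto dest: null_setsD2)
  obtain D where D: "D \<subseteq> {0..1}" "countable D" "emeasure Kdis ({0..1} - D) = 0" "D \<in> sets borel"
    using discrete_on_unitE[OF L(6)] .
  define B where "B = {c<..<d} - (N \<union> D)"
  have Bb: "B \<in> sets borel" using D(4) by (simp add: B_def)
  have B01: "B \<subseteq> {0..1}" using cd by (auto simp: B_def)
  have "N \<union> D \<in> null_sets lborel"
    using N D by (auto intro: countable_imp_null_set_lborel)
  then have "emeasure lborel B = emeasure lborel {c<..<d}"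
    unfolding B_def by (intro emeasure_Diff_null_set) auto
  then have "emeasure lborel B \<noteq> 0" using cd by simp
  then have "emeasure (K x) B \<noteq> 0"
    using Bb by (intro emeasure_K_pos_of_lborel[OF x cd(1,3) g m]) (auto simp: B_def)
  moreover have "emeasure Ksing B = 0"
    using B01 by (intro emeasure_zero_of_subset[OF N(3)]) (auto simp: B_def L(3) sets_unit_lebesgue_iff)
  moreover have "emeasure Kdis B = 0"
    using D B01 by (intro emeasure_zero_of_subset[OF D(3)]) (auto simp: B_def L(2) sets_unit_lebesgue_iff)
  ultimately have "emeasure Kabs B \<noteq> 0"
    using L(4)[of B] Bb B01 by (auto simp: sets_unit_lebesgue_iff)
  moreover have "emeasure Kabs B \<le> emeasure Kabs {c<..<d}"
    using cd by (intro emeasure_mono) (auto simp: L(1) sets_unit_lebesgue_iff B_def)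
  ultimately show ?thesis by auto
qed

end

section \<open>From the extreme contact points to strict inequalities\<close>

context pickands_pair
begin

text \<open>A contact at \<open>t\<close> would make the contact set nonempty; being compact, it has
  a maximum, so \<open>GREATEST\<close> really denotes that maximum, which is at least
  \<open>t > 0\<close>. The case of \<open>pickands_R\<close> is dual.\<close>

lemma A_gt_of_pickands_L:
  assumes L: "pickands_L A = 0" and t: "t \<in> {0<..<1}"
  shows "1 - t < A t"
proof (rule ccontr)
  assume "\<not> 1 - t < A t"
  then have At: "A t = 1 - t" using A_bounds(2)[of t] t by simp
  let ?Z = "{t \<in> {0..1}. A t - (1 - t) = 0}"
  have "compact ?Z" by (intro compact_zero_set continuous_intros A_continuous)
  moreover have "t \<in> ?Z" using t At by simp
  ultimately obtain s where s: "s \<in> ?Z" "\<And>u. u \<in> ?Z \<Longrightarrow> u \<le> s"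
    using compact_attains_sup[of ?Z] by blast
  have "pickands_L A = s"
    unfolding pickands_L_def using s by (intro Greatest_equality) auto
  with L s(2)[OF \<open>t \<in> ?Z\<close>] t show False by simp
qed

lemma A_gt_of_pickands_R:
  assumes R: "pickands_R A = 1" and t: "t \<in> {0<..<1}"
  shows "t < A t"
proof (rule ccontr)
  assume "\<not> t < A t"
  then have At: "A t = t" using A_bounds(1)[of t] t by simp
  let ?Z = "{t \<in> {0..1}. A t - t = 0}"
  have "compact ?Z" by (intro compact_zero_set continuous_intros A_continuous)
  moreover have "t \<in> ?Z" using t At by simp
  ultimately obtain s where s: "s \<in> ?Z" "\<And>u. u \<in> ?Z \<Longrightarrow> s \<le> u"
    using compact_attains_inf[of ?Z] by blast
  have "pickands_R A = s"
    unfolding pickands_R_def using s by (intro Least_equality) auto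
  with R s(2)[OF \<open>t \<in> ?Z\<close>] t show False by simp
qed

end

theorem lemma4p8:
  fixes C :: "real \<Rightarrow> real \<Rightarrow> real"
    and A :: "real \<Rightarrow> real"
    and \<theta> \<theta>abs \<theta>dis \<theta>sing :: "real measure"
    and K Kabs Kdis Ksing :: "real \<Rightarrow> real measure"
  assumes "evc C"
    and "pickands_measure \<theta>"
    and "pickands_function A"
    and "function_of_pickands_measure A \<theta>"
    and "copula_of_pickands_function C A"
    and "lebesgue_decomposition \<theta> \<theta>abs \<theta>dis \<theta>sing"
    and "markov_kernel_of C K"
    and "kernel_decomposition K Kabs Kdis Ksing"
  shows "(measure_support \<theta>dis = {0..1} \<longrightarrow>
            measure_support (kernel_measure Kdis) = {0..1} \<times> {0..1}) \<and>
         (measure_support \<theta>sing = {0..1} \<longrightarrow>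
            measure_support (kernel_measure Ksing) = {0..1} \<times> {0..1}) \<and>
         (pickands_L A = 0 \<and> pickands_R A = 1 \<longrightarrow>
            measure_support (kernel_measure Kabs) = {0..1} \<times> {0..1})"
proof -
  interpret evc_kernel A \<theta> C K
    using assms(1-5,7) by unfold_locales (simp_all add: evc_def)
  have kernels: "sub_markov_kernel Kabs" "sub_markov_kernel Kdis" "sub_markov_kernel Ksing"
    using assms(8) by (simp_all add: kernel_decomposition_def)
  have dec: "lebesgue_decomposition (K x) (Kabs x) (Kdis x) (Ksing x)" if "kernel_formula_at x" for x
    using assms(8) that by (auto simp: kernel_decomposition_def kernel_formula_at_def)
  \<comment> \<open>All three assertions reduce to positivity on open intervals at each
    \<open>x\<close> satisfying the kernel formula, since almost every \<open>x\<close> in the open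
    unit interval does.\<close>
  have support: "measure_support (kernel_measure K') = {0..1} \<times> {0..1}"
    if "sub_markov_kernel K'"
      and "\<And>x c d. kernel_formula_at x \<Longrightarrow> 0 < c \<Longrightarrow> c < d \<Longrightarrow> d < 1 \<Longrightarrow> emeasure (K' x) {c<..<d} \<noteq> 0"
    for K' :: "real \<Rightarrow> real measure"
  proof (rule kernel_measure_full_support[OF that(1)])
    show "AE x in lborel. x \<in> {0<..<1} \<longrightarrow>
        (\<forall>c d. 0 < c \<longrightarrow> c < d \<longrightarrow> d < 1 \<longrightarrow> emeasure (K' x) {c<..<d} \<noteq> 0)"
      using AE_kernel_formula_at by eventually_elim (use that(2) in blast)
  qed
  show ?thesis
  proof (intro conjI impI)
    assume "measure_support \<theta>dis = {0..1}"
    then show "measure_support (kernel_measure Kdis) = {0..1} \<times> {0..1}"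
      using Kdis_pos[OF _ assms(6) _ dec] by (intro support kernels)
  next
    assume "measure_support \<theta>sing = {0..1}"
    then show "measure_support (kernel_measure Ksing) = {0..1} \<times> {0..1}"
      using Ksing_pos[OF _ assms(6) _ dec] by (intro support kernels)
  next
    assume "pickands_L A = 0 \<and> pickands_R A = 1"
    then show "measure_support (kernel_measure Kabs) = {0..1} \<times> {0..1}"
      using Kabs_pos[OF _ A_gt_of_pickands_L A_gt_of_pickands_R dec] by (intro support kernels) blast
  qed
qed

end
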